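(* In general, the Cholesky-Vinberg mean $x\,\#_{\mathrm{cv}}\,y$ is not the Riemannian midpoint of $x$ and $y$ for the canonical Hessian metric; that is, there exist $x,y\in\Omega$ joined by a unique minimizing geodesic of $g^{\mathrm{can}}$ such that $x\,\#_{\mathrm{cv}}\,y$ is different from the midpoint of that geodesic.
   Context: Let $V\subset \mathrm{Sym}(3,\mathbb{R})$ be the 5-dimensional space of matrices $x=\begin{pmatrix} x_1 & 0 & x_4 \\ 0 & x_2 & x_5 \\ x_4 & x_5 & x_3 \end{pmatrix}$, $x_i\in\mathbb{R}$, and let $\Omega\subset V$ be the open cone of positive definite matrices in $V$. Let $H$ be the group of real lower triangular $3\times 3$ matrices with positive diagonal entries and zero $(2,1)$ entry. The map $\Phi:H\to\Omega$, $\Phi(T)=TT^{\top}$, is a diffeomorphism; $T_x:=\Phi^{-1}(x)\in H$ for $x\in\Omega$. The Cholesky-Vinberg mean is $x\,\#_{\mathrm{cv}}\,y:=\Phi\bigl(T_x(T_x^{-1}T_y)^{1/2}\bigr)$, where $T^{1/2}=\exp(\frac12\log T)$ is the principal square root. The canonical Hessian metric is the Riemannian metric on $\Omega$ (with $T_x\Omega\simeq V$) $$g^{\mathrm{can}}_x(u,v)=-\frac12\left(\frac{u_1v_1}{x_1^2}+\frac{u_2v_2}{x_2^2}\right)+2\,\mathrm{tr}(x^{-1}ux^{-1}v),$$ the Hessian of $\log\varphi_\Omega$ with $\varphi_\Omega(x)=c\,x_1^{1/2}x_2^{1/2}(\det x)^{-2}$. The Riemannian midpoint of two points joined by a unique minimizing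 geodesic $\sigma:[0,1]\to\Omega$ (parametrized affinely) is $\sigma(1/2)$. *)

theory Defs
  imports "HOL-Analysis.Analysis"
begin

section \<open>Principal logarithm and square root of a real matrix\<close>

text \<open>On \<open>real^'n^'n\<close> the type class product is componentwise, so the library's \<open>exp\<close> and
  \<open>ln\<close> do not provide the matrix functions.\<close>

definition mat_exp :: "real^'n^'n \<Rightarrow> real^'n^'n" where
  "mat_exp A = (\<Sum>k. (1 / fact k) *\<^sub>R (((**) A) ^^ k) (mat 1))"

definition complex_eigenvalue :: "real^'n^'n \<Rightarrow> complex \<Rightarrow> bool" where
  "complex_eigenvalue A z \<longleftrightarrow> det (mat z - (\<chi> i j. complex_of_real (A $ i $ j))) = 0"

text \<open>The principal logarithm of a real matrix without eigenvalues in \<open>(-\<infinity>, 0]\<close> is the unique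
  logarithm whose spectrum lies in the open strip of height \<open>2\<pi>\<close> around the real axis; it is real,
  so it suffices to range over real matrices.\<close>

definition mat_log :: "real^'n^'n \<Rightarrow> real^'n^'n" where
  "mat_log A = (THE L. mat_exp L = A \<and> (\<forall>z. complex_eigenvalue L z \<longrightarrow> \<bar>Im z\<bar> < pi))"

definition mat_sqrt :: "real^'n^'n \<Rightarrow> real^'n^'n" where
  "mat_sqrt A = mat_exp ((1 / 2) *\<^sub>R mat_log A)"

section \<open>The cone, the group and the Cholesky-Vinberg mean\<close>

definition V :: "(real^3^3) set" where
  "V = {x. transpose x = x \<and> x $ 1 $ 2 = 0}"

definition \<Omega> :: "(real^3^3) set" where
  "\<Omega> = {x \<in> V. \<forall>v. v \<noteq> 0 \<longrightarrow> 0 < v \<bullet> (x *v v)}"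

definition H :: "(real^3^3) set" where
  "H = {T. (\<forall>i. 0 < T $ i $ i) \<and> T $ 1 $ 2 = 0 \<and> T $ 1 $ 3 = 0 \<and> T $ 2 $ 3 = 0 \<and> T $ 2 $ 1 = 0}"

definition \<Phi> :: "real^3^3 \<Rightarrow> real^3^3" where
  "\<Phi> T = T ** transpose T"

definition chol :: "real^3^3 \<Rightarrow> real^3^3" where
  "chol = inv_into H \<Phi>"

definition cv_mean :: "real^3^3 \<Rightarrow> real^3^3 \<Rightarrow> real^3^3" where
  "cv_mean x y = \<Phi> (chol x ** mat_sqrt (matrix_inv (chol x) ** chol y))"

section \<open>The canonical Hessian metric\<close>

definition g_can :: "real^3^3 \<Rightarrow> real^3^3 \<Rightarrow> real^3^3 \<Rightarrow> real" where
  "g_can x u v =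
     - (1 / 2) * (u $ 1 $ 1 * v $ 1 $ 1 / (x $ 1 $ 1)\<^sup>2 + u $ 2 $ 2 * v $ 2 $ 2 / (x $ 2 $ 2)\<^sup>2)
     + 2 * trace (matrix_inv x ** u ** matrix_inv x ** v)"

section \<open>Minimizing geodesics on an open subset of a linear subspace\<close>

text \<open>Throughout, \<open>D\<close> is a relatively open subset of a linear subspace \<open>E\<close>, all tangent spaces are
  identified with \<open>E\<close>, and \<open>g p u v\<close> is a Riemannian metric on \<open>D\<close>.\<close>

definition dir_deriv :: "('a::real_normed_vector \<Rightarrow> real) \<Rightarrow> 'a \<Rightarrow> 'a \<Rightarrow> real" where
  "dir_deriv f p w = deriv (\<lambda>s. f (p + s *\<^sub>R w)) 0"

text \<open>Christoffel symbols of the first kind of the Levi-Civita connection: for constant vector fields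
  \<open>u, v, w\<close> this is the Koszul formula for \<open>g(\<nabla>\<^sub>u v, w)\<close>.\<close>

definition christoffel ::
  "('a::real_normed_vector \<Rightarrow> 'a \<Rightarrow> 'a \<Rightarrow> real) \<Rightarrow> 'a \<Rightarrow> 'a \<Rightarrow> 'a \<Rightarrow> 'a \<Rightarrow> real" where
  "christoffel g p u v w =
     (dir_deriv (\<lambda>q. g q v w) p u + dir_deriv (\<lambda>q. g q u w) p v - dir_deriv (\<lambda>q. g q u v) p w) / 2"

text \<open>The geodesic equation \<open>\<nabla>\<^bsub>\<sigma>'\<^esub> \<sigma>' = 0\<close>, tested against all tangent vectors. It makes the
  parametrization affine.\<close>

definition geodesic_in ::
  "'a set \<Rightarrow> 'a set \<Rightarrow> ('a::real_normed_vector \<Rightarrow> 'a \<Rightarrow> 'a \<Rightarrow> real) \<Rightarrow> (real \<Rightarrow> 'a) \<Rightarrow> bool" where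
  "geodesic_in E D g \<sigma> \<longleftrightarrow>
     (\<exists>\<sigma>' \<sigma>''. \<forall>t\<in>{0..1}.
        \<sigma> t \<in> D \<and>
        (\<sigma> has_vector_derivative \<sigma>' t) (at t within {0..1}) \<and>
        (\<sigma>' has_vector_derivative \<sigma>'' t) (at t within {0..1}) \<and>
        (\<forall>w\<in>E. g (\<sigma> t) (\<sigma>'' t) w + christoffel g (\<sigma> t) (\<sigma>' t) (\<sigma>' t) w = 0))"

definition speed ::
  "('a::real_normed_vector \<Rightarrow> 'a \<Rightarrow> 'a \<Rightarrow> real) \<Rightarrow> (real \<Rightarrow> 'a) \<Rightarrow> real \<Rightarrow> real" where
  "speed g \<gamma> t = sqrt (g (\<gamma> t) (vector_derivative \<gamma> (at t)) (vector_derivative \<gamma> (at t)))"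

definition riem_length ::
  "('a::real_normed_vector \<Rightarrow> 'a \<Rightarrow> 'a \<Rightarrow> real) \<Rightarrow> (real \<Rightarrow> 'a) \<Rightarrow> real" where
  "riem_length g \<gamma> = integral {0..1} (speed g \<gamma>)"

text \<open>The library's piecewise \<open>C\<^sup>1\<close> curves may have unbounded velocity at the break points.
  Integrability of the speed excludes exactly those of infinite length, on which
  \<^const>\<open>integral\<close> would return the junk value 0.\<close>

definition admissible_curve ::
  "'a set \<Rightarrow> ('a::real_normed_vector \<Rightarrow> 'a \<Rightarrow> 'a \<Rightarrow> real) \<Rightarrow> (real \<Rightarrow> 'a) \<Rightarrow> 'a \<Rightarrow> 'a \<Rightarrow> bool" where
  "admissible_curve D g \<gamma> x y \<longleftrightarrow>
     \<gamma> piecewise_C1_differentiable_on {0..1} \<and> speed g \<gamma> integrable_on {0..1} \<and>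
     \<gamma> ` {0..1} \<subseteq> D \<and> \<gamma> 0 = x \<and> \<gamma> 1 = y"

definition minimizing_geodesic ::
  "'a set \<Rightarrow> 'a set \<Rightarrow> ('a::real_normed_vector \<Rightarrow> 'a \<Rightarrow> 'a \<Rightarrow> real) \<Rightarrow> (real \<Rightarrow> 'a) \<Rightarrow> 'a \<Rightarrow> 'a \<Rightarrow> bool"
where
  "minimizing_geodesic E D g \<sigma> x y \<longleftrightarrow>
     geodesic_in E D g \<sigma> \<and> \<sigma> 0 = x \<and> \<sigma> 1 = y \<and>
     (\<forall>\<gamma>. admissible_curve D g \<gamma> x y \<longrightarrow> riem_length g \<sigma> \<le> riem_length g \<gamma>)"

end

theory Submission
  imports Defs
begin

text \<open>Write \<open>x = L diag(x\<^sub>1, x\<^sub>2, D) L\<^sup>T\<close> with \<open>L\<close> unipotent with last row \<open>(P, Q, 1)\<close>. In these coordinates the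
  metric is \<open>3/2 ((dx\<^sub>1/x\<^sub>1)\<^sup>2 + (dx\<^sub>2/x\<^sub>2)\<^sup>2) + 2 (dD/D)\<^sup>2 + 4 (x\<^sub>1/D) dP\<^sup>2 + 4 (x\<^sub>2/D) dQ\<^sup>2\<close>. Its part in
  \<open>(x\<^sub>1, D, P)\<close> is the product of a line, with coordinate \<open>3 ln x\<^sub>1 + 4 ln D\<close>, and a hyperbolic
  plane, modelled on the half plane with real part proportional to \<open>P\<close> and squared height \<open>D / x\<^sub>1\<close>.
  Take \<open>x\<close> and \<open>y\<close> with unipotent Cholesky factors, \<open>P = 6/7\<close> and \<open>P = 1\<close>. They have the same height,
  so the geodesic between them is an arc of a semicircle and its midpoint lies strictly higher, whereas the
  Cholesky-Vinberg mean has again a unipotent Cholesky factor, hence the same height as \<open>x\<close> and \<open>y\<close>.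
  An inversion of the half plane centred at a foot of the semicircle makes the geodesic vertical.
  The logarithm of the new height then calibrates it, and equality in the resulting length bound forces all
  other coordinates to be constant, which gives uniqueness.\<close>

section \<open>Matrix exponentials of unipotent matrices and the Cholesky-Vinberg mean\<close>

abbreviation mat_pow :: "real^'n^'n \<Rightarrow> nat \<Rightarrow> real^'n^'n" where
  "mat_pow A k \<equiv> (((**) A) ^^ k) (mat 1)"

lemma mat_pow_commute: "A ** mat_pow A k = mat_pow A k ** A"
proof (induction k)
  case (Suc k)
  then show ?case by (simp add: matrix_mul_assoc)
qed simp

text \<open>Each multiplication by \<open>A\<close> sums \<open>CARD('n)\<close> products, each at
  most \<open>M\<close> times the previous bound; the exponential series thus has a scalar
  exponential majorant.\<close>

lemma mat_pow_entry_bound: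
  fixes A :: "real^'n^'n" and M :: real
  assumes "\<And>i j. \<bar>A $ i $ j\<bar> \<le> M"
  shows "\<bar>mat_pow A k $ i $ j\<bar> \<le> (CARD('n) * M) ^ k"
proof (induction k arbitrary: i j)
  case 0
  then show ?case by (simp add: mat_def)
next
  case (Suc k)
  have "\<bar>mat_pow A (Suc k) $ i $ j\<bar> \<le> (\<Sum>l\<in>UNIV. \<bar>A $ i $ l * mat_pow A k $ l $ j\<bar>)"
    by (simp add: matrix_matrix_mult_def)
  also have "\<dots> \<le> (\<Sum>l\<in>(UNIV::'n set). M * (CARD('n) * M) ^ k)"
    unfolding abs_mult by (intro sum_mono mult_mono assms Suc) (use assms order_trans abs_ge_zero in blast, simp)
  finally show ?case by simp
qed

lemma mat_exp_sums:
  fixes A :: "real^'n^'n"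
  shows "(\<lambda>k. mat_pow A k $ i $ j / fact k) sums (mat_exp A $ i $ j)"
proof -
  obtain M where M: "\<And>i j. \<bar>A $ i $ j\<bar> \<le> M"
  proof
    show "\<bar>A $ i $ j\<bar> \<le> norm A" for i j
      using component_le_norm_cart[of "A $ i" j] Finite_Cartesian_Product.norm_nth_le[of A i] by simp
  qed
  have "summable (\<lambda>k. mat_pow A k $ i $ j / fact k)" for i j
  proof (rule summable_comparison_test')
    show "summable (\<lambda>k. inverse (fact k) * (CARD('n) * M) ^ k)"
      by (rule summable_exp)
    show "norm (mat_pow A k $ i $ j / fact k) \<le> inverse (fact k) * (CARD('n) * M) ^ k" for k
      using mat_pow_entry_bound[OF M, of k i j] by (simp add: field_simps)
  qed
  then have "(\<lambda>k. (1 / fact k) *\<^sub>R mat_pow A k) sums (\<chi> i j. \<Sum>k. mat_pow A k $ i $ j / fact k)"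
    unfolding sums_def by (intro vec_tendstoI) (simp add: sum_component summable_LIMSEQ)
  then have s: "(\<lambda>k. (1 / fact k) *\<^sub>R mat_pow A k) sums mat_exp A"
    unfolding mat_exp_def by (simp add: sums_iff)
  show ?thesis
    using tendsto_vec_nth[OF tendsto_vec_nth[OF s[unfolded sums_def], of i], of j]
    by (simp add: sums_def sum_component)
qed

text \<open>\<open>A\<close> commutes with its powers, so each entry of the two products is the sum
  of the same series.\<close>

lemma mat_exp_commute: "A ** mat_exp A = mat_exp A ** A" for A :: "real^'n^'n"
proof -
  have "(A ** mat_exp A) $ i $ j = (mat_exp A ** A) $ i $ j" for i j
  proof (rule sums_unique2)
    show "(\<lambda>k. \<Sum>l\<in>UNIV. A $ i $ l * (mat_pow A k $ l $ j / fact k)) sums ((A ** mat_exp A) $ i $ j)"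
      by (simp only: matrix_matrix_mult_def vec_lambda_beta) (intro sums_sum sums_mult mat_exp_sums)
    have "(\<Sum>l\<in>UNIV. A $ i $ l * (mat_pow A k $ l $ j / fact k))
        = (\<Sum>l\<in>UNIV. mat_pow A k $ i $ l / fact k * A $ l $ j)" for k
      using arg_cong[OF mat_pow_commute[of A k], of "\<lambda>B. B $ i $ j"]
      by (simp add: matrix_matrix_mult_def sum_divide_distrib[symmetric])
    then show "(\<lambda>k. \<Sum>l\<in>UNIV. A $ i $ l * (mat_pow A k $ l $ j / fact k)) sums ((mat_exp A ** A) $ i $ j)"
      by (simp only: matrix_matrix_mult_def vec_lambda_beta) (intro sums_sum sums_mult2 mat_exp_sums)
  qed
  then show ?thesis by (simp add: vec_eq_iff)
qed

lemma mat_exp_nilpotent: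
  fixes A :: "real^'n^'n"
  assumes "A ** (A ** A) = 0"
  shows "mat_exp A = mat 1 + A + (1 / 2) *\<^sub>R (A ** A)"
proof -
  have "mat_pow A (k + 3) = 0" for k
    using assms by (induction k) (simp_all add: numeral_3_eq_3)
  then have z: "mat_pow A k = 0" if "k \<notin> {..<3}" for k
    using that by (metis add.commute le_iff_add lessThan_iff not_less)
  have "(\<lambda>k. mat_pow A k $ i $ j / fact k) sums (\<Sum>k<3. mat_pow A k $ i $ j / fact k)" for i j
    by (rule sums_finite) (simp_all add: z)
  then have "mat_exp A $ i $ j = (\<Sum>k<3. mat_pow A k $ i $ j / fact k)" for i j
    using mat_exp_sums sums_unique2 by blast
  then show ?thesis
    by (simp add: vec_eq_iff numeral_3_eq_3 numeral_2_eq_2)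
qed

text \<open>Powers of a lower triangular matrix stay lower triangular, and their diagonal entries
  are powers of the diagonal entries. Hence each diagonal entry is a scalar exponential
  series.\<close>

lemma mat_exp_diag_lower_triangular:
  fixes A :: "real^3^3"
  assumes "A $ 1 $ 2 = 0" "A $ 1 $ 3 = 0" "A $ 2 $ 3 = 0"
  shows "mat_exp A $ i $ i = exp (A $ i $ i)"
proof -
  have "mat_pow A k $ 1 $ 2 = 0 \<and> mat_pow A k $ 1 $ 3 = 0 \<and> mat_pow A k $ 2 $ 3 = 0
      \<and> (\<forall>i. mat_pow A k $ i $ i = A $ i $ i ^ k)" for k
    using assms by (induction k) (simp_all add: matrix_matrix_mult_def sum_3 forall_3 mat_def)
  then have "mat_pow A k $ i $ i / fact k = (A $ i $ i) ^ k /\<^sub>R fact k" for k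
    by (simp add: divide_inverse mult.commute)
  then show ?thesis
    using mat_exp_sums[of A i i] exp_converges[of "A $ i $ i"] sums_unique2 by simp
qed

section \<open>A one-parameter group of unipotent matrices: logarithm and square root\<close>

definition unip :: "real \<Rightarrow> real^3^3" where
  "unip p = (\<chi> i j. if i = j then 1 else if i = 3 \<and> j = 1 then p else 0)"

lemma unip_entries [simp]:
  "unip p $ 1 $ 1 = 1" "unip p $ 1 $ 2 = 0" "unip p $ 1 $ 3 = 0"
  "unip p $ 2 $ 1 = 0" "unip p $ 2 $ 2 = 1" "unip p $ 2 $ 3 = 0"
  "unip p $ 3 $ 1 = p" "unip p $ 3 $ 2 = 0" "unip p $ 3 $ 3 = 1"
  by (simp_all add: unip_def)

lemma unip_mult: "unip p ** unip q = unip (p + q)"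
  by (simp add: vec_eq_iff forall_3 matrix_matrix_mult_def sum_3)

lemma unip_0: "unip 0 = mat 1"
  by (simp add: vec_eq_iff forall_3 mat_def)

lemma mat_exp_unip: "mat_exp (unip p - mat 1) = unip p"
proof -
  have "(unip p - mat 1) ** (unip p - mat 1) = 0"
    by (simp add: vec_eq_iff forall_3 matrix_matrix_mult_def sum_3 mat_def)
  then show ?thesis
    using mat_exp_nilpotent[of "unip p - mat 1"] by simp
qed

text \<open>\<open>L\<close> commutes with \<open>mat_exp L\<close>, which forces it to be lower triangular, so that its
  real diagonal is determined.\<close>

lemma mat_exp_eq_unipD:
  assumes exp: "mat_exp L = unip p" and "p \<noteq> 0"
  shows "L = unip p - mat 1"
proof -
  have "L ** unip p = unip p ** L"
    using mat_exp_commute[of L] exp by simp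
  \<comment> \<open>At the positions (3,2), (1,1) and (2,1) the two sides differ by \<open>p\<close>
    times these entries, up to sign.\<close>
  then have "L $ 1 $ 2 = 0" "L $ 1 $ 3 = 0" "L $ 2 $ 3 = 0"
    using \<open>p \<noteq> 0\<close> by (auto simp: vec_eq_iff forall_3 matrix_matrix_mult_def sum_3)
  note tri = this
  have "exp (L $ i $ i) = 1" for i
    using mat_exp_diag_lower_triangular[OF tri, of i] exp by (simp add: unip_def)
  then have diag: "L $ i $ i = 0" for i
    by simp
  have "L ** (L ** L) = 0"
    using tri diag by (simp add: vec_eq_iff forall_3 matrix_matrix_mult_def sum_3)
  \<comment> \<open>\<open>L ** L\<close> can be nonzero only at (3,1). The other positions give
    \<open>L $ 2 $ 1 = 0\<close> and \<open>L $ 3 $ 2 = 0\<close>, and then the square vanishes as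
    well.\<close>
  then have "mat 1 + L + (1 / 2) *\<^sub>R (L ** L) = unip p"
    using mat_exp_nilpotent exp by metis
  then show ?thesis
    using tri diag by (auto simp: vec_eq_iff forall_3 matrix_matrix_mult_def sum_3 mat_def)
qed

text \<open>The characteristic polynomial is z^3, so this logarithm satisfies the spectral condition
  in \<open>mat_log\<close>.\<close>

lemma complex_eigenvalue_unip_minus_1: "complex_eigenvalue (unip p - mat 1) z \<longleftrightarrow> z = 0"
  by (simp add: complex_eigenvalue_def det_3 mat_def)

lemma mat_log_unip:
  assumes "p \<noteq> 0"
  shows "mat_log (unip p) = unip p - mat 1"
  unfolding mat_log_def
proof (rule the_equality)
  show "mat_exp (unip p - mat 1) = unip p
      \<and> (\<forall>z. complex_eigenvalue (unip p - mat 1) z \<longrightarrow> \<bar>Im z\<bar> < pi)"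
    by (simp add: mat_exp_unip complex_eigenvalue_unip_minus_1)
qed (use assms mat_exp_eq_unipD in blast)

lemma mat_sqrt_unip:
  assumes "p \<noteq> 0"
  shows "mat_sqrt (unip p) = unip (p / 2)"
proof -
  have "(1 / 2) *\<^sub>R (unip p - mat 1) = unip (p / 2) - mat 1"
    by (simp add: vec_eq_iff forall_3 mat_def)
  then show ?thesis
    by (simp add: mat_sqrt_def mat_log_unip[OF assms] mat_exp_unip)
qed

section \<open>Evaluation of the mean on unipotent Cholesky factors\<close>

lemma matrix_inv_eqI:
  fixes A B :: "real^'n^'n"
  assumes "A ** B = mat 1"
  shows "matrix_inv A = B"
proof -
  have "\<exists>A'. A ** A' = mat 1 \<and> A' ** A = mat 1"
    using assms matrix_left_right_inverse by blast
  then have "A ** matrix_inv A = mat 1 \<and> matrix_inv A ** A = mat 1"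
    unfolding matrix_inv_def by (rule someI_ex)
  then show ?thesis
    using assms by (metis matrix_mul_assoc matrix_mul_lid matrix_mul_rid)
qed

lemma matrix_inv_unip: "matrix_inv (unip p) = unip (- p)"
  by (rule matrix_inv_eqI) (simp add: unip_mult unip_0)

text \<open>The Cholesky algorithm: two diagonal entries are positive roots, division by them gives
  the third row up to its diagonal entry, which is again a positive root. Injectivity is what
  evaluates \<open>chol\<close>, an \<open>inv_into\<close>.\<close>

lemma inj_on_Phi: "inj_on \<Phi> H"
proof (rule inj_onI)
  fix T U assume T: "T \<in> H" and U: "U \<in> H" and eq: "\<Phi> T = \<Phi> U"
  have zeros: "A $ 1 $ 2 = 0" "A $ 1 $ 3 = 0" "A $ 2 $ 1 = 0" "A $ 2 $ 3 = 0"
    and pos: "A $ i $ i > 0" if "A \<in> H" for A i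
    using that by (auto simp: H_def)
  have e: "(\<Phi> A) $ i $ j = (\<Sum>k\<in>UNIV. A $ i $ k * A $ j $ k)" for A i j
    by (simp add: \<Phi>_def matrix_matrix_mult_def transpose_def)
  have ij: "(\<Sum>k\<in>UNIV. T $ i $ k * T $ j $ k) = (\<Sum>k\<in>UNIV. U $ i $ k * U $ j $ k)" for i j
    using eq e by metis
  note simps = sum_3 zeros[OF T] zeros[OF U]
  have sq: "a = b" if "a * a = b * b" "a > 0" "b > 0" for a b :: real
    using that by (simp add: square_eq_iff)
  have 1: "T $ 1 $ 1 = U $ 1 $ 1"
    by (rule sq[OF _ pos[OF T] pos[OF U]]) (use ij[of 1 1] in \<open>simp add: simps\<close>)
  have 2: "T $ 2 $ 2 = U $ 2 $ 2"
    by (rule sq[OF _ pos[OF T] pos[OF U]]) (use ij[of 2 2] in \<open>simp add: simps\<close>)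
  have 31: "T $ 3 $ 1 = U $ 3 $ 1"
    using ij[of 1 3] 1 pos[OF U, of 1] by (simp add: simps)
  have 32: "T $ 3 $ 2 = U $ 3 $ 2"
    using ij[of 2 3] 2 pos[OF U, of 2] by (simp add: simps)
  have "T $ 3 $ 3 = U $ 3 $ 3"
    by (rule sq[OF _ pos[OF T] pos[OF U]]) (use ij[of 3 3] 31 32 in \<open>simp add: simps\<close>)
  with 1 2 31 32 show "T = U"
    by (simp add: vec_eq_iff forall_3 zeros[OF T] zeros[OF U])
qed

lemma unip_in_H: "unip p \<in> H"
  by (simp add: H_def forall_3)

lemma chol_Phi_unip: "chol (\<Phi> (unip p)) = unip p"
  unfolding chol_def by (rule inv_into_f_f[OF inj_on_Phi unip_in_H])

text \<open>Since \<open>unip\<close> turns addition into multiplication, the square root halves the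
  difference \<open>q - p\<close>.\<close>

lemma cv_mean_unip:
  assumes "p \<noteq> q"
  shows "cv_mean (\<Phi> (unip p)) (\<Phi> (unip q)) = \<Phi> (unip ((p + q) / 2))"
proof -
  have "matrix_inv (unip p) ** unip q = unip (q - p)"
    by (simp add: matrix_inv_unip unip_mult)
  moreover have "p + (q - p) / 2 = (p + q) / 2"
    by (simp add: field_simps)
  ultimately show ?thesis
    using assms by (simp only: cv_mean_def chol_Phi_unip mat_sqrt_unip[of "q - p"] unip_mult right_minus_eq)
qed

section \<open>The canonical metric in Cholesky coordinates\<close>

lemma V_iff: "x \<in> V \<longleftrightarrow> x $ 1 $ 2 = 0 \<and> x $ 2 $ 1 = 0 \<and> x $ 3 $ 1 = x $ 1 $ 3 \<and> x $ 3 $ 2 = x $ 2 $ 3"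
  by (auto simp: V_def transpose_def vec_eq_iff forall_3)

text \<open>The numbers \<open>dP x u\<close> and \<open>dQ x u\<close> are the differentials of \<open>cP\<close> and \<open>cQ\<close> multiplied by
  \<open>x $ 1 $ 1\<close> and \<open>x $ 2 $ 2\<close>, whereas \<open>dD x u\<close> is the differential of \<open>cD\<close> itself.\<close>

definition cP :: "real^3^3 \<Rightarrow> real" where "cP x = x $ 1 $ 3 / x $ 1 $ 1"
definition cQ :: "real^3^3 \<Rightarrow> real" where "cQ x = x $ 2 $ 3 / x $ 2 $ 2"
definition cD :: "real^3^3 \<Rightarrow> real" where
  "cD x = x $ 3 $ 3 - (x $ 1 $ 3)\<^sup>2 / x $ 1 $ 1 - (x $ 2 $ 3)\<^sup>2 / x $ 2 $ 2"

definition dP :: "real^3^3 \<Rightarrow> real^3^3 \<Rightarrow> real" where "dP x u = u $ 1 $ 3 - cP x * u $ 1 $ 1"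
definition dQ :: "real^3^3 \<Rightarrow> real^3^3 \<Rightarrow> real" where "dQ x u = u $ 2 $ 3 - cQ x * u $ 2 $ 2"
definition dD :: "real^3^3 \<Rightarrow> real^3^3 \<Rightarrow> real" where
  "dD x u = u $ 3 $ 3 - 2 * cP x * u $ 1 $ 3 - 2 * cQ x * u $ 2 $ 3 + (cP x)\<^sup>2 * u $ 1 $ 1 + (cQ x)\<^sup>2 * u $ 2 $ 2"

text \<open>All denominators of the coordinate formulas are nonzero. The condition is open along
  lines, as differentiation requires.\<close>

definition nondeg :: "real^3^3 \<Rightarrow> bool" where
  "nondeg x \<longleftrightarrow> x $ 1 $ 1 \<noteq> 0 \<and> x $ 2 $ 2 \<noteq> 0 \<and> cD x \<noteq> 0"

definition g_coord :: "real^3^3 \<Rightarrow> real^3^3 \<Rightarrow> real^3^3 \<Rightarrow> real" where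
  "g_coord x u v =
     3 / 2 * (u $ 1 $ 1 * v $ 1 $ 1 / (x $ 1 $ 1)\<^sup>2 + u $ 2 $ 2 * v $ 2 $ 2 / (x $ 2 $ 2)\<^sup>2)
     + 2 * dD x u * dD x v / (cD x)\<^sup>2
     + 4 * dP x u * dP x v / (x $ 1 $ 1 * cD x) + 4 * dQ x u * dQ x v / (x $ 2 $ 2 * cD x)"

lemma coord_entries:
  assumes "nondeg x"
  shows "x $ 1 $ 3 = cP x * x $ 1 $ 1" "x $ 2 $ 3 = cQ x * x $ 2 $ 2"
    "x $ 3 $ 3 = cD x + (cP x)\<^sup>2 * x $ 1 $ 1 + (cQ x)\<^sup>2 * x $ 2 $ 2"
  using assms by (simp_all add: nondeg_def cP_def cQ_def cD_def field_simps power2_eq_square)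

text \<open>Completing squares diagonalizes the quadratic form; \<open>cD\<close> is the Schur
  complement of the upper left block.\<close>

lemma Omega_iff: "x \<in> \<Omega> \<longleftrightarrow> x \<in> V \<and> 0 < x $ 1 $ 1 \<and> 0 < x $ 2 $ 2 \<and> 0 < cD x"
proof -
  have q: "v \<bullet> (x *v v) = x $ 1 $ 1 * (v $ 1 + cP x * v $ 3)\<^sup>2 + x $ 2 $ 2 * (v $ 2 + cQ x * v $ 3)\<^sup>2 + cD x * (v $ 3)\<^sup>2"
    if "x \<in> V" "x $ 1 $ 1 \<noteq> 0" "x $ 2 $ 2 \<noteq> 0" for v
    using that unfolding V_iff
    by (simp add: inner_vec_def matrix_vector_mult_def sum_3 cP_def cQ_def cD_def field_simps power2_eq_square)
  show ?thesis
  proof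
    assume x: "x \<in> \<Omega>"
    then have pos: "0 < v \<bullet> (x *v v)" if "v \<noteq> 0" for v
      using that by (simp add: \<Omega>_def)
    have x1: "0 < x $ 1 $ 1"
      using pos[of "axis 1 1"] by (simp add: matrix_vector_mul_component inner_axis' inner_axis)
    have x2: "0 < x $ 2 $ 2"
      using pos[of "axis 2 1"] by (simp add: matrix_vector_mul_component inner_axis' inner_axis)
    \<comment> \<open>On this vector the first two squares vanish and only \<open>cD x\<close>
      remains.\<close>
    have "vector [- cP x, - cQ x, 1] \<noteq> (0 :: real^3)"
      by (simp add: vec_eq_iff forall_3)
    from pos[OF this] have "0 < cD x"
      using x x1 x2 by (simp add: q \<Omega>_def)
    then show "x \<in> V \<and> 0 < x $ 1 $ 1 \<and> 0 < x $ 2 $ 2 \<and> 0 < cD x"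
      using x x1 x2 by (simp add: \<Omega>_def)
  next
    assume x: "x \<in> V \<and> 0 < x $ 1 $ 1 \<and> 0 < x $ 2 $ 2 \<and> 0 < cD x"
    have "0 < v \<bullet> (x *v v)" if "v \<noteq> 0" for v
    proof -
      have nonneg: "0 \<le> x $ 1 $ 1 * (v $ 1 + cP x * v $ 3)\<^sup>2" "0 \<le> x $ 2 $ 2 * (v $ 2 + cQ x * v $ 3)\<^sup>2"
        "0 \<le> cD x * (v $ 3)\<^sup>2"
        using x by simp_all
      have "0 < x $ 1 $ 1 * (v $ 1 + cP x * v $ 3)\<^sup>2 \<or> 0 < x $ 2 $ 2 * (v $ 2 + cQ x * v $ 3)\<^sup>2
          \<or> 0 < cD x * (v $ 3)\<^sup>2"
        using that x by (cases "v $ 3 = 0") (auto simp: vec_eq_iff forall_3)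
      then show ?thesis
        using q[of v] x nonneg by linarith
    qed
    then show "x \<in> \<Omega>"
      using x by (simp add: \<Omega>_def)
  qed
qed

lemma Omega_nondeg: "x \<in> \<Omega> \<Longrightarrow> nondeg x"
  by (simp add: Omega_iff nondeg_def)

lemma matrix_inv_coord:
  assumes "x \<in> V" "nondeg x"
  shows "matrix_inv x = vector [
      vector [1 / x $ 1 $ 1 + (cP x)\<^sup>2 / cD x, cP x * cQ x / cD x, - cP x / cD x],
      vector [cP x * cQ x / cD x, 1 / x $ 2 $ 2 + (cQ x)\<^sup>2 / cD x, - cQ x / cD x],
      vector [- cP x / cD x, - cQ x / cD x, 1 / cD x]]"
  using assms(1) assms(2)[unfolded nondeg_def] unfolding V_iff
  by (intro matrix_inv_eqI)
     (simp add: vec_eq_iff forall_3 matrix_matrix_mult_def sum_3 mat_def coord_entries[OF assms(2)]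
       field_simps power2_eq_square)

text \<open>With the unipotent factor L of x, the trace only involves the entries of L^-1 u L^-T and
  L^-1 v L^-T. Their diagonals are \<open>u $ 1 $ 1\<close>, \<open>u $ 2 $ 2\<close>,
  \<open>dD x u\<close> and the same for v; off the diagonal stand \<open>dP\<close> and
  \<open>dQ\<close>.\<close>

lemma g_can_eq_g_coord:
  assumes x: "x \<in> V" "nondeg x" and u: "u \<in> V" and v: "v \<in> V"
  shows "g_can x u v = g_coord x u v"
proof -
  \<comment> \<open>Naming the reciprocals makes the trace identity polynomial.\<close>
  define a b c where "a = 1 / x $ 1 $ 1" and "b = 1 / x $ 2 $ 2" and "c = 1 / cD x"
  have inv: "matrix_inv x = vector [
      vector [a + (cP x)\<^sup>2 * c, cP x * cQ x * c, - cP x * c],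
      vector [cP x * cQ x * c, b + (cQ x)\<^sup>2 * c, - cQ x * c],
      vector [- cP x * c, - cQ x * c, c]]"
    by (simp add: matrix_inv_coord[OF x] a_def b_def c_def)
  have "g_can x u v = - (1 / 2) * (u $ 1 $ 1 * v $ 1 $ 1 * a\<^sup>2 + u $ 2 $ 2 * v $ 2 $ 2 * b\<^sup>2)
      + 2 * trace (matrix_inv x ** u ** matrix_inv x ** v)"
    by (simp add: g_can_def a_def b_def power_divide)
  also have "trace (matrix_inv x ** u ** matrix_inv x ** v) =
      u $ 1 $ 1 * v $ 1 $ 1 * a\<^sup>2 + u $ 2 $ 2 * v $ 2 $ 2 * b\<^sup>2 + dD x u * dD x v * c\<^sup>2
      + 2 * dP x u * dP x v * a * c + 2 * dQ x u * dQ x v * b * c"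
    using u v unfolding V_iff inv
    by (simp add: trace_def matrix_matrix_mult_def sum_3 dP_def dQ_def dD_def)
       (simp add: power2_eq_square algebra_simps)
  also have "- (1 / 2) * (u $ 1 $ 1 * v $ 1 $ 1 * a\<^sup>2 + u $ 2 $ 2 * v $ 2 $ 2 * b\<^sup>2) + 2 * \<dots> = g_coord x u v"
    by (simp add: g_coord_def a_def b_def c_def power_divide field_simps)
  finally show ?thesis .
qed

section \<open>Derivatives of the coordinates and of the metric; Christoffel symbols\<close>

lemma has_real_derivative_entry:
  fixes X :: "real \<Rightarrow> real^'n^'m"
  assumes "(X has_vector_derivative X') F"
  shows "((\<lambda>t. X t $ i $ j) has_real_derivative X' $ i $ j) F"
  using bounded_linear.has_vector_derivative[OF bounded_linear_vec_nth bounded_linear.has_vector_derivative[OF bounded_linear_vec_nth assms]]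
  by (simp add: has_real_derivative_iff_has_vector_derivative)

lemma derivs_coord:
  assumes X: "(X has_vector_derivative X') (at t within S)"
  shows DERIV_cP: "X t $ 1 $ 1 \<noteq> 0 \<Longrightarrow> ((\<lambda>t. cP (X t)) has_real_derivative dP (X t) X' / X t $ 1 $ 1) (at t within S)"
    and DERIV_cQ: "X t $ 2 $ 2 \<noteq> 0 \<Longrightarrow> ((\<lambda>t. cQ (X t)) has_real_derivative dQ (X t) X' / X t $ 2 $ 2) (at t within S)"
    and DERIV_cD: "X t $ 1 $ 1 \<noteq> 0 \<Longrightarrow> X t $ 2 $ 2 \<noteq> 0 \<Longrightarrow> ((\<lambda>t. cD (X t)) has_real_derivative dD (X t) X') (at t within S)"
  unfolding cP_def cQ_def cD_def dP_def dQ_def dD_def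
  by (auto intro!: derivative_eq_intros has_real_derivative_entry[OF X] simp: field_simps power2_eq_square)

text \<open>The correction terms come from the motion of \<open>cP\<close> and \<open>cQ\<close>; in
  \<open>dD\<close> they regroup into \<open>dP\<close> and \<open>dQ\<close> of
  \<open>U t\<close>.\<close>

lemma derivs_tangent:
  assumes X: "(X has_vector_derivative X') (at t within S)" and U: "(U has_vector_derivative U') (at t within S)"
  shows DERIV_dP: "X t $ 1 $ 1 \<noteq> 0 \<Longrightarrow> ((\<lambda>t. dP (X t) (U t)) has_real_derivative
            dP (X t) U' - dP (X t) X' * U t $ 1 $ 1 / X t $ 1 $ 1) (at t within S)"
    and DERIV_dQ: "X t $ 2 $ 2 \<noteq> 0 \<Longrightarrow> ((\<lambda>t. dQ (X t) (U t)) has_real_derivative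
            dQ (X t) U' - dQ (X t) X' * U t $ 2 $ 2 / X t $ 2 $ 2) (at t within S)"
    and DERIV_dD: "X t $ 1 $ 1 \<noteq> 0 \<Longrightarrow> X t $ 2 $ 2 \<noteq> 0 \<Longrightarrow> ((\<lambda>t. dD (X t) (U t)) has_real_derivative
            dD (X t) U' - 2 * dP (X t) X' * dP (X t) (U t) / X t $ 1 $ 1
              - 2 * dQ (X t) X' * dQ (X t) (U t) / X t $ 2 $ 2) (at t within S)"
proof -
  note e = has_real_derivative_entry[OF U] DERIV_cP[OF X] DERIV_cQ[OF X]
  show "X t $ 1 $ 1 \<noteq> 0 \<Longrightarrow> ((\<lambda>t. dP (X t) (U t)) has_real_derivative
            dP (X t) U' - dP (X t) X' * U t $ 1 $ 1 / X t $ 1 $ 1) (at t within S)"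
    unfolding dP_def[of _ "U _"] dP_def[of _ "U'"]
    by (auto intro!: derivative_eq_intros e)
  show "X t $ 2 $ 2 \<noteq> 0 \<Longrightarrow> ((\<lambda>t. dQ (X t) (U t)) has_real_derivative
            dQ (X t) U' - dQ (X t) X' * U t $ 2 $ 2 / X t $ 2 $ 2) (at t within S)"
    unfolding dQ_def[of _ "U _"] dQ_def[of _ "U'"]
    by (auto intro!: derivative_eq_intros e)
  show "X t $ 1 $ 1 \<noteq> 0 \<Longrightarrow> X t $ 2 $ 2 \<noteq> 0 \<Longrightarrow> ((\<lambda>t. dD (X t) (U t)) has_real_derivative
            dD (X t) U' - 2 * dP (X t) X' * dP (X t) (U t) / X t $ 1 $ 1
              - 2 * dQ (X t) X' * dQ (X t) (U t) / X t $ 2 $ 2) (at t within S)"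
    unfolding dD_def dP_def[of _ "U _"] dQ_def[of _ "U _"]
    by (auto intro!: derivative_eq_intros e simp: field_simps power2_eq_square)
qed

text \<open>The derivative of \<open>g_coord x u v\<close> in the direction \<open>w\<close>. It is totally symmetric because the metric
  is a Hessian, so that the Christoffel symbol is half of it.\<close>

definition dg_coord :: "real^3^3 \<Rightarrow> real^3^3 \<Rightarrow> real^3^3 \<Rightarrow> real^3^3 \<Rightarrow> real" where
  "dg_coord x u v w =
     - 3 * (u $ 1 $ 1 * v $ 1 $ 1 * w $ 1 $ 1 / (x $ 1 $ 1) ^ 3 + u $ 2 $ 2 * v $ 2 $ 2 * w $ 2 $ 2 / (x $ 2 $ 2) ^ 3)
     - 4 * dD x u * dD x v * dD x w / (cD x) ^ 3
     - 4 * (dP x u * dP x v * dD x w + dP x u * dD x v * dP x w + dD x u * dP x v * dP x w) / (x $ 1 $ 1 * (cD x)\<^sup>2)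
     - 4 * (dP x u * dP x v * w $ 1 $ 1 + dP x u * v $ 1 $ 1 * dP x w + u $ 1 $ 1 * dP x v * dP x w) / ((x $ 1 $ 1)\<^sup>2 * cD x)
     - 4 * (dQ x u * dQ x v * dD x w + dQ x u * dD x v * dQ x w + dD x u * dQ x v * dQ x w) / (x $ 2 $ 2 * (cD x)\<^sup>2)
     - 4 * (dQ x u * dQ x v * w $ 2 $ 2 + dQ x u * v $ 2 $ 2 * dQ x w + u $ 2 $ 2 * dQ x v * dQ x w) / ((x $ 2 $ 2)\<^sup>2 * cD x)"

lemma DERIV_g_coord:
  assumes X: "(X has_vector_derivative X') (at t within S)" and U: "(U has_vector_derivative U') (at t within S)"
    and W: "(W has_vector_derivative W') (at t within S)" and nd: "nondeg (X t)"
  shows "((\<lambda>t. g_coord (X t) (U t) (W t)) has_real_derivative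
     dg_coord (X t) (U t) (W t) X' + g_coord (X t) U' (W t) + g_coord (X t) (U t) W') (at t within S)"
proof -
  note e = has_real_derivative_entry[OF X] has_real_derivative_entry[OF U] has_real_derivative_entry[OF W]
    DERIV_cD[OF X] DERIV_dP[OF X U] DERIV_dQ[OF X U] DERIV_dD[OF X U]
    DERIV_dP[OF X W] DERIV_dQ[OF X W] DERIV_dD[OF X W]
  show ?thesis
    using nd unfolding nondeg_def g_coord_def dg_coord_def divide_inverse power2_eq_square power3_eq_cube inverse_mult_distrib
    by (auto intro!: derivative_eq_intros e[unfolded divide_inverse]
        simp: algebra_simps add_divide_distrib diff_divide_distrib)
qed

lemma has_vector_derivative_line: "((\<lambda>s. x + s *\<^sub>R w) has_vector_derivative w) (at s within S)"
  by (auto intro!: derivative_eq_intros)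

lemma line_in_V: "x \<in> V \<Longrightarrow> w \<in> V \<Longrightarrow> x + s *\<^sub>R w \<in> V"
  by (simp add: V_iff)

text \<open>The derivative at 0 depends only on small \<open>s\<close>, for which the line stays in
  \<open>V\<close> and nondegenerate, so that \<open>g_can\<close> may be replaced by
  \<open>g_coord\<close>.\<close>

lemma dir_deriv_g_can:
  assumes x: "x \<in> V" "nondeg x" and u: "u \<in> V" and v: "v \<in> V" and w: "w \<in> V"
  shows "dir_deriv (\<lambda>q. g_can q u v) x w = dg_coord x u v w"
proof -
  let ?X = "\<lambda>s. x + s *\<^sub>R w"
  have X: "(?X has_vector_derivative w) (at 0)"
    by (rule has_vector_derivative_line)
  have nd: "nondeg (?X 0)" "?X 0 $ 1 $ 1 \<noteq> 0" "?X 0 $ 2 $ 2 \<noteq> 0"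
    using x by (simp_all add: nondeg_def)
  have "((\<lambda>s. g_coord (?X s) u v) has_real_derivative dg_coord (?X 0) u v w + g_coord (?X 0) 0 v + g_coord (?X 0) u 0) (at 0)"
    by (rule DERIV_g_coord[OF X _ _ nd(1)]) (rule has_vector_derivative_const)+
  then have d: "((\<lambda>s. g_coord (?X s) u v) has_real_derivative dg_coord x u v w) (at 0)"
    by (simp add: g_coord_def dP_def dQ_def dD_def)
  have "eventually (\<lambda>s. ?X s $ 1 $ 1 \<noteq> 0) (at 0)" "eventually (\<lambda>s. ?X s $ 2 $ 2 \<noteq> 0) (at 0)"
    "eventually (\<lambda>s. cD (?X s) \<noteq> 0) (at 0)"
    using DERIV_isCont[OF has_real_derivative_entry[OF X, of 1 1]] DERIV_isCont[OF has_real_derivative_entry[OF X, of 2 2]]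
      DERIV_isCont[OF DERIV_cD[OF X nd(2,3)]] nd(1)
    unfolding isCont_def nondeg_def by (simp_all add: tendsto_imp_eventually_ne)
  then have "eventually (\<lambda>s. g_coord (?X s) u v = g_can (?X s) u v) (at 0)"
  proof eventually_elim
    case (elim s)
    then show ?case
      using g_can_eq_g_coord[OF line_in_V[OF x(1) w] _ u v] by (simp add: nondeg_def)
  qed
  with d have "((\<lambda>s. g_can (?X s) u v) has_real_derivative dg_coord x u v w) (at 0)"
    using has_field_derivative_cong_eventually[of "\<lambda>s. g_coord (?X s) u v" "\<lambda>s. g_can (?X s) u v" 0 UNIV]
      g_can_eq_g_coord[OF x u v] by simp
  then show ?thesis
    by (simp add: dir_deriv_def DERIV_imp_deriv)
qed

lemma christoffel_g_can:
  assumes "x \<in> V" "nondeg x" "u \<in> V" "w \<in> V"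
  shows "christoffel g_can x u u w = dg_coord x u u w / 2"
  using assms by (simp add: christoffel_def dir_deriv_g_can) (simp add: dg_coord_def algebra_simps)

section \<open>A calibration for the canonical metric\<close>

text \<open>\<open>cF\<close> is the logarithm of the height and \<open>cX\<close> a multiple of the real part after the inversion of the
  half plane in the point \<open>P = 0\<close> of its boundary.\<close>

definition cW :: "real^3^3 \<Rightarrow> real" where "cW x = cD x + 7 / 6 * (cP x)\<^sup>2 * x $ 1 $ 1"
definition cF :: "real^3^3 \<Rightarrow> real" where "cF x = (ln (x $ 1 $ 1) + ln (cD x)) / 2 - ln (cW x)"
definition cX :: "real^3^3 \<Rightarrow> real" where "cX x = cP x * x $ 1 $ 1 / cW x"
definition cR :: "real^3^3 \<Rightarrow> real" where "cR x = 3 * ln (x $ 1 $ 1) + 4 * ln (cD x)"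

text \<open>These four are the actual differentials of \<open>cW\<close>, \<open>cF\<close>,
  \<open>cX\<close> and \<open>cR\<close>; the factor \<open>x $ 1 $ 1\<close> carried by
  \<open>dP\<close> cancels against the one in \<open>cW\<close> and \<open>cX\<close>.\<close>

definition dW :: "real^3^3 \<Rightarrow> real^3^3 \<Rightarrow> real" where
  "dW x u = dD x u + 7 / 3 * cP x * dP x u + 7 / 6 * (cP x)\<^sup>2 * u $ 1 $ 1"
definition dF :: "real^3^3 \<Rightarrow> real^3^3 \<Rightarrow> real" where
  "dF x u = (u $ 1 $ 1 / x $ 1 $ 1 + dD x u / cD x) / 2 - dW x u / cW x"
definition dX :: "real^3^3 \<Rightarrow> real^3^3 \<Rightarrow> real" where
  "dX x u = (dP x u + cP x * u $ 1 $ 1) / cW x - cP x * x $ 1 $ 1 * dW x u / (cW x)\<^sup>2"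
definition dR :: "real^3^3 \<Rightarrow> real^3^3 \<Rightarrow> real" where
  "dR x u = 3 * u $ 1 $ 1 / x $ 1 $ 1 + 4 * dD x u / cD x"

lemma Omega_pos:
  assumes "x \<in> \<Omega>"
  shows "0 < x $ 1 $ 1" "0 < x $ 2 $ 2" "0 < cD x" "0 < cW x"
  using assms by (auto simp: Omega_iff cW_def intro: add_pos_nonneg)

text \<open>Height sqrt(D/x1) and real part sqrt(7/6) P turn the hyperbolic factor into 24/7 times
  the standard half plane metric. Its inversion in the origin is an isometry, so \<open>dF\<close>
  and \<open>dX\<close> give the same form as the original coordinates.\<close>

lemma g_coord_sum_squares:
  assumes "x \<in> \<Omega>"
  shows "g_coord x u u = 24 / 7 * (dF x u)\<^sup>2 + (dR x u)\<^sup>2 / 14 + 4 * (cW x)\<^sup>2 * (dX x u)\<^sup>2 / (x $ 1 $ 1 * cD x)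
     + 3 / 2 * (u $ 2 $ 2 / x $ 2 $ 2)\<^sup>2 + 4 * (dQ x u)\<^sup>2 / (x $ 2 $ 2 * cD x)"
proof -
  define x1 D P W where "x1 = x $ 1 $ 1" and "D = cD x" and "P = cP x" and "W = cW x"
  define a d z M where "a = u $ 1 $ 1 / x1" and "d = dD x u / D" and "z = dP x u" and "M = D - 7 / 6 * P\<^sup>2 * x1"
  have pos: "0 < x1" "0 < D" "0 < W"
    using Omega_pos[OF assms] by (simp_all add: x1_def D_def W_def)
  have W: "W = D + 7 / 6 * P\<^sup>2 * x1"
    by (simp add: W_def cW_def D_def P_def x1_def)
  have u: "u $ 1 $ 1 = a * x1" "dD x u = d * D"
    using pos by (simp_all add: a_def d_def)
  have dW: "dW x u = d * D + 7 / 3 * P * z + 7 / 6 * P\<^sup>2 * (a * x1)"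
    by (simp add: dW_def u P_def z_def)
  have F: "dF x u = ((a - d) * M / 2 - 7 / 3 * P * z) / W"
  proof -
    have "dF x u = (a + d) / 2 - dW x u / W"
      using pos by (simp add: dF_def a_def d_def x1_def D_def W_def)
    also have "\<dots> = ((a + d) / 2 * W - dW x u) / W"
      using pos by (simp add: field_simps)
    also have "(a + d) / 2 * W - dW x u = (a - d) * M / 2 - 7 / 3 * P * z"
      unfolding dW W M_def by (simp add: field_simps power2_eq_square)
    finally show ?thesis .
  qed
  have X: "dX x u = (z * M + P * x1 * D * (a - d)) / W\<^sup>2"
  proof -
    have "dX x u = (z + P * (a * x1)) / W - P * x1 * dW x u / W\<^sup>2"
      by (simp add: dX_def z_def P_def u x1_def[symmetric] W_def)
    also have "\<dots> = ((z + P * (a * x1)) * W - P * x1 * dW x u) / W\<^sup>2"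
      using pos by (simp add: field_simps power2_eq_square)
    also have "(z + P * (a * x1)) * W - P * x1 * dW x u = z * M + P * x1 * D * (a - d)"
      unfolding dW W M_def by (simp add: field_simps power2_eq_square)
    finally show ?thesis .
  qed
  have W2: "W\<^sup>2 = M\<^sup>2 + 14 / 3 * P\<^sup>2 * x1 * D"
    unfolding W M_def by (simp add: field_simps power2_eq_square)
  \<comment> \<open>The inversion as an isometry, on tangent vectors: the mixed terms cancel, and
    the remaining ones combine through \<open>W2\<close>.\<close>
  have key: "24 / 7 * ((a - d) * M / 2 - 7 / 3 * P * z)\<^sup>2 * (x1 * D) + 4 * (z * M + P * x1 * D * (a - d))\<^sup>2
      = W\<^sup>2 * (6 / 7 * (a - d)\<^sup>2 * (x1 * D) + 4 * z\<^sup>2)"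
    unfolding W2 by (simp add: field_simps power2_eq_square)
  have common: "24 / 7 * (N / W)\<^sup>2 + 4 * W\<^sup>2 * (N' / W\<^sup>2)\<^sup>2 / e = (24 / 7 * N\<^sup>2 * e + 4 * N'\<^sup>2) / (W\<^sup>2 * e)"
    if "0 < e" for N N' e
    using that pos(3) by (simp add: field_simps power2_eq_square)
  have "24 / 7 * (dF x u)\<^sup>2 + 4 * W\<^sup>2 * (dX x u)\<^sup>2 / (x1 * D) =
     (24 / 7 * ((a - d) * M / 2 - 7 / 3 * P * z)\<^sup>2 * (x1 * D) + 4 * (z * M + P * x1 * D * (a - d))\<^sup>2) / (W\<^sup>2 * (x1 * D))"
    unfolding F X using pos by (intro common) simp
  also have "\<dots> = 6 / 7 * (a - d)\<^sup>2 + 4 * z\<^sup>2 / (x1 * D)"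
    unfolding key using pos by (simp add: add_divide_distrib)
  finally have FX: "24 / 7 * (dF x u)\<^sup>2 + 4 * W\<^sup>2 * (dX x u)\<^sup>2 / (x1 * D) = 6 / 7 * (a - d)\<^sup>2 + 4 * z\<^sup>2 / (x1 * D)" .
  have R: "dR x u = 3 * a + 4 * d"
    by (simp add: dR_def a_def d_def x1_def D_def)
  have "g_coord x u u = 3 / 2 * a\<^sup>2 + 2 * d\<^sup>2 + 4 * z\<^sup>2 / (x1 * D)
      + 3 / 2 * (u $ 2 $ 2 / x $ 2 $ 2)\<^sup>2 + 4 * (dQ x u)\<^sup>2 / (x $ 2 $ 2 * D)"
    by (simp add: g_coord_def a_def d_def z_def x1_def D_def power_divide power2_eq_square ring_distribs)
  \<comment> \<open>The combination 3a + 4d is orthogonal to a - d for this form, which splits off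
    the line factor.\<close>
  also have "3 / 2 * a\<^sup>2 + 2 * d\<^sup>2 = 6 / 7 * (a - d)\<^sup>2 + (dR x u)\<^sup>2 / 14"
    unfolding R by (simp add: field_simps power2_eq_square)
  finally show ?thesis
    using FX by (simp add: x1_def D_def W_def)
qed

lemma derivs_adapted:
  assumes X: "(X has_vector_derivative X') (at t within S)" and Om: "X t \<in> \<Omega>"
  shows DERIV_cF: "((\<lambda>t. cF (X t)) has_real_derivative dF (X t) X') (at t within S)"
    and DERIV_cX: "((\<lambda>t. cX (X t)) has_real_derivative dX (X t) X') (at t within S)"
    and DERIV_cR: "((\<lambda>t. cR (X t)) has_real_derivative dR (X t) X') (at t within S)"
proof -
  have pos: "0 < X t $ 1 $ 1" "0 < X t $ 2 $ 2" "0 < cD (X t)" "0 < cW (X t)"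
    using Omega_pos[OF Om] by auto
  note e = has_real_derivative_entry[OF X] DERIV_cD[OF X] DERIV_cP[OF X]
  have W: "((\<lambda>t. cW (X t)) has_real_derivative dW (X t) X') (at t within S)"
    unfolding cW_def dW_def using pos by (auto intro!: derivative_eq_intros e)
  show "((\<lambda>t. cF (X t)) has_real_derivative dF (X t) X') (at t within S)"
    unfolding cF_def dF_def using pos by (auto intro!: derivative_eq_intros e W simp: add_divide_distrib)
  show "((\<lambda>t. cX (X t)) has_real_derivative dX (X t) X') (at t within S)"
    unfolding cX_def dX_def using pos
    by (auto intro!: derivative_eq_intros e W simp: diff_divide_distrib power2_eq_square)
  show "((\<lambda>t. cR (X t)) has_real_derivative dR (X t) X') (at t within S)"
    unfolding cR_def dR_def using pos by (auto intro!: derivative_eq_intros e simp: field_simps)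
qed

lemma continuous_on_adapted:
  assumes "continuous_on S X" "X ` S \<subseteq> \<Omega>"
  shows "continuous_on S (\<lambda>t. cF (X t))" "continuous_on S (\<lambda>t. cX (X t))" "continuous_on S (\<lambda>t. cR (X t))"
    "continuous_on S (\<lambda>t. cQ (X t))"
proof -
  have ne: "\<forall>t\<in>S. X t $ 1 $ 1 \<noteq> 0" "\<forall>t\<in>S. X t $ 2 $ 2 \<noteq> 0" "\<forall>t\<in>S. cD (X t) \<noteq> 0" "\<forall>t\<in>S. cW (X t) \<noteq> 0"
    using assms(2) Omega_pos by (metis image_subset_iff less_irrefl)+
  have P: "continuous_on S (\<lambda>t. cP (X t))"
    unfolding cP_def using ne by (auto intro!: continuous_intros assms(1))
  have D: "continuous_on S (\<lambda>t. cD (X t))"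
    unfolding cD_def using ne by (auto intro!: continuous_intros assms(1))
  have W: "continuous_on S (\<lambda>t. cW (X t))"
    unfolding cW_def by (intro continuous_intros P D assms(1))
  show "continuous_on S (\<lambda>t. cF (X t))"
    unfolding cF_def using ne by (auto intro!: continuous_intros P D W assms(1))
  show "continuous_on S (\<lambda>t. cX (X t))"
    unfolding cX_def using ne by (auto intro!: continuous_intros P D W assms(1))
  show "continuous_on S (\<lambda>t. cR (X t))"
    unfolding cR_def using ne by (auto intro!: continuous_intros P D W assms(1))
  show "continuous_on S (\<lambda>t. cQ (X t))"
    unfolding cQ_def using ne by (auto intro!: continuous_intros assms(1))
qed

text \<open>The squared modulus of the inverted point is determined by \<open>cF\<close> and
  \<open>cX\<close>, and it equals \<open>x $ 1 $ 1 / cW x\<close>. Together with \<open>cF\<close>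
  and \<open>cR\<close> this is a nonsingular linear system for the logarithms of
  \<open>x $ 1 $ 1\<close>, \<open>cD x\<close> and \<open>cW x\<close>.\<close>

lemma adapted_coords_inject:
  assumes x: "x \<in> \<Omega>" and y: "y \<in> \<Omega>"
    and "cF x = cF y" "cX x = cX y" "cR x = cR y" "cQ x = cQ y" "x $ 2 $ 2 = y $ 2 $ 2"
  shows "x = y"
proof -
  have m: "z $ 1 $ 1 / cW z = exp (2 * cF z) + 7 / 6 * (cX z)\<^sup>2" if "z \<in> \<Omega>" for z
  proof -
    note pos = Omega_pos[OF that]
    have "exp (2 * cF z) = exp (ln (z $ 1 $ 1) + ln (cD z) - 2 * ln (cW z))"
      by (simp add: cF_def algebra_simps)
    also have "\<dots> = z $ 1 $ 1 * cD z / (cW z)\<^sup>2"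
      using pos by (simp add: exp_diff exp_add exp_double)
    finally have "exp (2 * cF z) + 7 / 6 * (cX z)\<^sup>2 = z $ 1 $ 1 * (cD z + 7 / 6 * (cP z)\<^sup>2 * z $ 1 $ 1) / (cW z)\<^sup>2"
      using pos by (simp add: cX_def field_simps power2_eq_square)
    also have "\<dots> = z $ 1 $ 1 / cW z"
      using pos unfolding cW_def[symmetric] by (simp add: power2_eq_square)
    finally show ?thesis by simp
  qed
  have m1: "x $ 1 $ 1 / cW x = y $ 1 $ 1 / cW y"
    using m[OF x] m[OF y] assms by simp
  have "ln (z $ 1 $ 1 / cW z) = ln (z $ 1 $ 1) - ln (cW z)" if "z \<in> \<Omega>" for z
    using Omega_pos[OF that] by (simp add: ln_div)
  then have "ln (x $ 1 $ 1) - ln (cW x) = ln (y $ 1 $ 1) - ln (cW y)"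
    using m1 x y by metis
  then have "ln (cW x) = ln (cW y)" "ln (cD x) = ln (cD y)"
    using assms(3,5) unfolding cF_def cR_def by argo+
  then have W: "cW x = cW y" and D: "cD x = cD y"
    using Omega_pos[OF x] Omega_pos[OF y] by auto
  then have x1: "x $ 1 $ 1 = y $ 1 $ 1"
    using m1 Omega_pos[OF y] by simp
  then have P: "cP x = cP y"
    using W assms(4) Omega_pos[OF y] by (simp add: cX_def)
  show ?thesis
    using coord_entries[OF Omega_nondeg[OF x]] coord_entries[OF Omega_nondeg[OF y]] x y assms(6,7) D x1 P
    by (auto simp: vec_eq_iff forall_3 Omega_iff V_iff)
qed

section \<open>The lower bound for lengths of curves\<close>

text \<open>\<open>V\<close> is cut out by linear equations between entries, which pass to
  derivatives by their uniqueness on the closed interval, end points included.\<close>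

lemma vector_derivative_in_V:
  assumes "(X has_vector_derivative X') (at t within {0..1})" "t \<in> {0..1}" "\<And>s. s \<in> {0..1} \<Longrightarrow> X s \<in> V"
  shows "X' \<in> V"
proof -
  have z: "X' $ i $ j = X' $ k $ l" if "\<And>s. s \<in> {0..1} \<Longrightarrow> X s $ i $ j = X s $ k $ l" for i j k l
  proof (rule vector_derivative_unique_within_closed_interval[of 0 1 t])
    show "((\<lambda>s. X s $ i $ j) has_vector_derivative X' $ i $ j) (at t within cbox 0 1)"
      using has_real_derivative_entry[OF assms(1)] by (simp add: has_real_derivative_iff_has_vector_derivative)
    have "((\<lambda>s. X s $ k $ l) has_vector_derivative X' $ k $ l) (at t within {0..1})"
      using has_real_derivative_entry[OF assms(1)] by (simp add: has_real_derivative_iff_has_vector_derivative)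
    then show "((\<lambda>s. X s $ i $ j) has_vector_derivative X' $ k $ l) (at t within cbox 0 1)"
      using has_vector_derivative_transform[OF assms(2), of "\<lambda>s. X s $ i $ j" "\<lambda>s. X s $ k $ l"] that by simp
  qed (use assms(2) in auto)
  have "X' $ 1 $ 2 = 0"
  proof (rule vector_derivative_unique_within_closed_interval[of 0 1 t])
    show "((\<lambda>s. X s $ 1 $ 2) has_vector_derivative X' $ 1 $ 2) (at t within cbox 0 1)"
      using has_real_derivative_entry[OF assms(1)] by (simp add: has_real_derivative_iff_has_vector_derivative)
    show "((\<lambda>s. X s $ 1 $ 2) has_vector_derivative 0) (at t within cbox 0 1)"
      using has_vector_derivative_transform[OF assms(2), of "\<lambda>s. X s $ 1 $ 2" "\<lambda>s. 0"] assms(3) by (simp add: V_iff)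
  qed (use assms(2) in auto)
  moreover have "X' $ 1 $ 2 = X' $ 2 $ 1" "X' $ 3 $ 1 = X' $ 1 $ 3" "X' $ 3 $ 2 = X' $ 2 $ 3"
    using assms(3) by (auto intro!: z simp: V_iff)
  ultimately show ?thesis by (simp add: V_iff)
qed

lemma g_can_ge:
  assumes "x \<in> \<Omega>" "u \<in> V"
  shows "24 / 7 * (dF x u)\<^sup>2 \<le> g_can x u u"
proof -
  note pos = Omega_pos[OF assms(1)]
  have "g_can x u u = g_coord x u u"
    using assms by (intro g_can_eq_g_coord) (auto simp: Omega_iff Omega_nondeg)
  then show ?thesis
    using pos by (simp add: g_coord_sum_squares[OF assms(1)])
qed

text \<open>The speed dominates the derivative of \<open>- sqrt (24 / 7) * cF\<close> along the
  curve; integrate.\<close>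

lemma riem_length_ge:
  assumes "admissible_curve \<Omega> g_can \<gamma> x y"
  shows "sqrt (24 / 7) * (cF x - cF y) \<le> riem_length g_can \<gamma>"
proof -
  let ?v = "\<lambda>t. vector_derivative \<gamma> (at t)"
  obtain S where S: "finite S" "\<gamma> C1_differentiable_on ({0..1} - S)" and cont: "continuous_on {0..1} \<gamma>"
    using assms unfolding admissible_curve_def piecewise_C1_differentiable_on_def by blast
  have im: "\<gamma> t \<in> \<Omega>" if "t \<in> {0..1}" for t
    using assms that unfolding admissible_curve_def by blast
  have der: "(\<gamma> has_vector_derivative ?v t) (at t)" if "t \<in> {0..1} - S" for t
    using S(2) that unfolding C1_differentiable_on_def by (metis vector_derivative_at)
  \<comment> \<open>On the finite exceptional set \<open>f\<close> is the speed itself: the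
    comparison then holds at every point, and the fundamental theorem disregards these
    points.\<close>
  define f where "f t = (if t \<in> S then speed g_can \<gamma> t else - sqrt (24 / 7) * dF (\<gamma> t) (?v t))" for t
  have "(f has_integral (- sqrt (24 / 7) * cF (\<gamma> 1) - - sqrt (24 / 7) * cF (\<gamma> 0))) {0..1}"
  proof (rule fundamental_theorem_of_calculus_strong[OF S(1)])
    show "((\<lambda>t. - sqrt (24 / 7) * cF (\<gamma> t)) has_vector_derivative f t) (at t)" if "t \<in> {0..1} - S" for t
      using DERIV_cmult[OF DERIV_cF[OF der[OF that] im], of "- sqrt (24 / 7)"] that
      by (simp add: f_def has_real_derivative_iff_has_vector_derivative)
    show "continuous_on {0..1} (\<lambda>t. - sqrt (24 / 7) * cF (\<gamma> t))"
      using im by (intro continuous_intros continuous_on_adapted(1)[OF cont]) auto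
  qed simp
  moreover have "(speed g_can \<gamma> has_integral riem_length g_can \<gamma>) {0..1}"
    using assms unfolding admissible_curve_def riem_length_def by (simp add: integrable_integral)
  moreover have "f t \<le> speed g_can \<gamma> t" if t: "t \<in> {0..1}" for t
  proof (cases "t \<in> S")
    case False
    have "?v t \<in> V"
      using False t im
      by (intro vector_derivative_in_V[OF has_vector_derivative_at_within[OF der]]) (auto simp: Omega_iff)
    then have "sqrt (24 / 7 * (dF (\<gamma> t) (?v t))\<^sup>2) \<le> speed g_can \<gamma> t"
      unfolding speed_def by (intro real_sqrt_le_mono g_can_ge im t)
    moreover have "- sqrt (24 / 7) * dF (\<gamma> t) (?v t) \<le> sqrt (24 / 7 * (dF (\<gamma> t) (?v t))\<^sup>2)"
      unfolding real_sqrt_mult real_sqrt_abs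
      by (metis abs_ge_minus_self minus_mult_commute mult_left_mono real_sqrt_ge_zero zero_le_divide_iff zero_le_numeral)
    ultimately show ?thesis
      using False by (simp add: f_def)
  qed (simp add: f_def)
  ultimately have "- sqrt (24 / 7) * cF (\<gamma> 1) - - sqrt (24 / 7) * cF (\<gamma> 0) \<le> riem_length g_can \<gamma>"
    by (rule has_integral_le)
  then show ?thesis
    using assms by (simp add: admissible_curve_def algebra_simps)
qed

section \<open>Constant speed of geodesics and equality in the length bound\<close>

text \<open>The derivative of the squared speed is twice the geodesic equation tested against the
  velocity itself.\<close>

lemma geodesic_speed_constant:
  assumes in_Om: "\<And>t. t \<in> {0..1} \<Longrightarrow> \<sigma> t \<in> \<Omega>"
    and d1: "\<And>t. t \<in> {0..1} \<Longrightarrow> (\<sigma> has_vector_derivative \<sigma>' t) (at t within {0..1})"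
    and d2: "\<And>t. t \<in> {0..1} \<Longrightarrow> (\<sigma>' has_vector_derivative \<sigma>'' t) (at t within {0..1})"
    and geo: "\<And>t w. t \<in> {0..1} \<Longrightarrow> w \<in> V \<Longrightarrow>
      g_can (\<sigma> t) (\<sigma>'' t) w + christoffel g_can (\<sigma> t) (\<sigma>' t) (\<sigma>' t) w = 0"
  shows "\<exists>c. \<forall>t\<in>{0..1}. g_can (\<sigma> t) (\<sigma>' t) (\<sigma>' t) = c"
proof -
  have in_V: "\<sigma> t \<in> V" and nd: "nondeg (\<sigma> t)" if "t \<in> {0..1}" for t
    using in_Om[OF that] by (auto simp: Omega_iff Omega_nondeg)
  have V1: "\<sigma>' t \<in> V" if "t \<in> {0..1}" for t
    using vector_derivative_in_V[OF d1] that in_V by blast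
  have V2: "\<sigma>'' t \<in> V" if "t \<in> {0..1}" for t
    using vector_derivative_in_V[OF d2] that V1 by blast
  have "\<exists>c. \<forall>t\<in>{0..1}. g_coord (\<sigma> t) (\<sigma>' t) (\<sigma>' t) = c"
  proof (rule has_field_derivative_zero_constant)
    fix t :: real assume t: "t \<in> {0..1}"
    have "g_coord (\<sigma> t) (\<sigma>'' t) (\<sigma>' t) + dg_coord (\<sigma> t) (\<sigma>' t) (\<sigma>' t) (\<sigma>' t) / 2 = 0"
      using geo[OF t V1[OF t]]
      unfolding g_can_eq_g_coord[OF in_V[OF t] nd[OF t] V2[OF t] V1[OF t]]
        christoffel_g_can[OF in_V[OF t] nd[OF t] V1[OF t] V1[OF t]] .
    moreover have "g_coord (\<sigma> t) (\<sigma>' t) (\<sigma>'' t) = g_coord (\<sigma> t) (\<sigma>'' t) (\<sigma>' t)"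
      by (simp add: g_coord_def mult_ac)
    ultimately show "((\<lambda>t. g_coord (\<sigma> t) (\<sigma>' t) (\<sigma>' t)) has_real_derivative 0) (at t within {0..1})"
      by (intro DERIV_cong[OF DERIV_g_coord[OF d1[OF t] d2[OF t] d2[OF t] nd[OF t]]]) simp
  qed simp
  then show ?thesis
    using g_can_eq_g_coord in_V nd V1 by simp
qed

text \<open>\<open>speed\<close> uses the two-sided derivative, which the one-sided hypothesis does
  not control at 0 and 1; these two points are discarded from the integral.\<close>

lemma riem_length_constant_speed:
  assumes "\<And>t. t \<in> {0..1} \<Longrightarrow> (\<sigma> has_vector_derivative \<sigma>' t) (at t within {0..1})"
    and "\<And>t. t \<in> {0..1} \<Longrightarrow> g (\<sigma> t) (\<sigma>' t) (\<sigma>' t) = c"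
  shows "(speed g \<sigma> has_integral sqrt c) {0..1}"
proof (rule has_integral_spike_finite[where S = "{0, 1}"])
  show "((\<lambda>t::real. sqrt c) has_integral sqrt c) {0..1}"
    using has_integral_const_real[of "sqrt c" 0 1] by simp
  fix t :: real assume "t \<in> {0..1} - {0, 1}"
  then have t: "t \<in> {0..1}" "0 < t" "t < 1"
    by auto
  have "(\<sigma> has_vector_derivative \<sigma>' t) (at t)"
    using assms(1)[OF t(1)] at_within_Icc_at[OF t(2,3)] by simp
  then show "speed g \<sigma> t = sqrt c"
    using assms(2)[OF t(1)] by (simp add: speed_def vector_derivative_at)
qed simp

text \<open>Equality in the length bound leaves no room for the other squares in \<open>g_coord_sum_squares\<close>.\<close>

lemma short_geodesic_coords:
  assumes geo: "geodesic_in V \<Omega> g_can \<sigma>"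
    and short: "riem_length g_can \<sigma> \<le> sqrt (24 / 7) * (cF (\<sigma> 0) - cF (\<sigma> 1))"
    and t: "t \<in> {0..1}"
  shows "cF (\<sigma> t) = cF (\<sigma> 0) - (cF (\<sigma> 0) - cF (\<sigma> 1)) * t" "cX (\<sigma> t) = cX (\<sigma> 0)" "cR (\<sigma> t) = cR (\<sigma> 0)"
    "cQ (\<sigma> t) = cQ (\<sigma> 0)" "\<sigma> t $ 2 $ 2 = \<sigma> 0 $ 2 $ 2"
proof -
  obtain \<sigma>' \<sigma>'' where *: "\<forall>t\<in>{0..1}. \<sigma> t \<in> \<Omega> \<and>
        (\<sigma> has_vector_derivative \<sigma>' t) (at t within {0..1}) \<and>
        (\<sigma>' has_vector_derivative \<sigma>'' t) (at t within {0..1}) \<and>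
        (\<forall>w\<in>V. g_can (\<sigma> t) (\<sigma>'' t) w + christoffel g_can (\<sigma> t) (\<sigma>' t) (\<sigma>' t) w = 0)"
    using geo unfolding geodesic_in_def by blast
  then obtain c where c: "\<And>t. t \<in> {0..1} \<Longrightarrow> g_can (\<sigma> t) (\<sigma>' t) (\<sigma>' t) = c"
    using geodesic_speed_constant[of \<sigma> \<sigma>' \<sigma>''] by blast
  have in_Om: "\<sigma> t \<in> \<Omega>" and d1: "(\<sigma> has_vector_derivative \<sigma>' t) (at t within {0..1})" if "t \<in> {0..1}" for t
    using * that by auto
  have V1: "\<sigma>' t \<in> V" if "t \<in> {0..1}" for t
    using vector_derivative_in_V[OF d1[OF that] that] in_Om by (simp add: Omega_iff)
  have d: "(\<sigma> has_vector_derivative \<sigma>' t) (at t)" if "0 < t" "t < 1" for t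
    using d1[of t] at_within_Icc_at[OF that] that by simp
  have cont: "continuous_on {0..1} \<sigma>"
    using d1 has_vector_derivative_continuous continuous_on_eq_continuous_within by blast
  note conts = continuous_on_adapted[OF cont, unfolded image_subset_iff, OF ballI[OF in_Om]]
  define k where "k = cF (\<sigma> 0) - cF (\<sigma> 1)"
  have len: "riem_length g_can \<sigma> = sqrt c"
    using riem_length_constant_speed[OF d1, of g_can c] c by (simp add: riem_length_def integral_unique)
  have ge: "24 / 7 * (dF (\<sigma> t) (\<sigma>' t))\<^sup>2 \<le> c" if "t \<in> {0..1}" for t
    using g_can_ge[OF in_Om[OF that] V1[OF that]] c[OF that] by simp
  have "0 \<le> c"
    using ge[of 0] by (smt (verit) atLeastAtMost_iff zero_le_power2 mult_nonneg_nonneg divide_nonneg_nonneg)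
  then have "0 \<le> sqrt (24 / 7) * k"
    using short real_sqrt_ge_zero[of c] unfolding len k_def by linarith
  then have "0 \<le> k"
    by (simp add: zero_le_mult_iff)
  have "sqrt c \<le> sqrt (24 / 7 * k\<^sup>2)"
    using short \<open>0 \<le> k\<close> unfolding len real_sqrt_mult k_def by simp
  \<comment> \<open>Constant speed turns the bound on the length into a pointwise bound on the
    squared velocity.\<close>
  then have c_le: "c \<le> 24 / 7 * k\<^sup>2"
    by (simp only: real_sqrt_le_iff)
  have F_ge: "- k \<le> dF (\<sigma> t) (\<sigma>' t)" if "t \<in> {0..1}" for t
  proof -
    have "(dF (\<sigma> t) (\<sigma>' t))\<^sup>2 \<le> k\<^sup>2"
      using ge[OF that] c_le by simp
    then show ?thesis
      using \<open>0 \<le> k\<close> abs_le_square_iff[of "dF (\<sigma> t) (\<sigma>' t)" k] by simp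
  qed
  have dG: "((\<lambda>t. cF (\<sigma> t) + k * t) has_real_derivative dF (\<sigma> t) (\<sigma>' t) + k) (at t)" if "0 < t" "t < 1" for t
    using that by (auto intro!: derivative_eq_intros DERIV_cF[OF d] in_Om)
  \<comment> \<open>A nondecreasing function with equal values at 0 and 1, by the choice of
    \<open>k\<close>, is constant.\<close>
  have mono: "cF (\<sigma> s) + k * s \<le> cF (\<sigma> t) + k * t" if "0 \<le> s" "s \<le> t" "t \<le> 1" for s t
  proof (rule DERIV_nonneg_imp_increasing_open[OF that(2)])
    show "\<exists>y. ((\<lambda>t. cF (\<sigma> t) + k * t) has_real_derivative y) (at r) \<and> 0 \<le> y" if "s < r" "r < t" for r
      using dG[of r] F_ge[of r] that \<open>0 \<le> s\<close> \<open>t \<le> 1\<close> by force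
    show "continuous_on {s..t} (\<lambda>t. cF (\<sigma> t) + k * t)"
      using that by (intro continuous_intros continuous_on_subset[OF conts(1)]) auto
  qed
  have F: "cF (\<sigma> t) + k * t = cF (\<sigma> 0)" if "t \<in> {0..1}" for t
    using mono[of 0 t] mono[of t 1] that by (simp add: k_def)
  show "cF (\<sigma> t) = cF (\<sigma> 0) - (cF (\<sigma> 0) - cF (\<sigma> 1)) * t"
    using F[OF t] unfolding k_def by linarith
  have zero: "dX (\<sigma> t) (\<sigma>' t) = 0 \<and> dR (\<sigma> t) (\<sigma>' t) = 0 \<and> dQ (\<sigma> t) (\<sigma>' t) = 0 \<and> \<sigma>' t $ 2 $ 2 = 0"
    if t: "0 < t" "t < 1" for t
  proof -
    have tI: "t \<in> {0..1}" using t by simp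
    note pos = Omega_pos[OF in_Om[OF tI]]
    have "((\<lambda>t. cF (\<sigma> 0)) has_real_derivative dF (\<sigma> t) (\<sigma>' t) + k) (at t)"
      by (rule has_field_derivative_transform_within_open[OF dG[OF t], of "{0<..<1}"]) (use t F in auto)
    then have "dF (\<sigma> t) (\<sigma>' t) + k = 0"
      using DERIV_unique DERIV_const by blast
    then have F: "dF (\<sigma> t) (\<sigma>' t) = - k"
      by simp
    \<comment> \<open>The square of \<open>dF\<close> already exhausts the bound, so the sum of the
      other nonnegative terms is at most 0.\<close>
    have "g_coord (\<sigma> t) (\<sigma>' t) (\<sigma>' t) \<le> 24 / 7 * k\<^sup>2"
      using c_le c[OF tI] g_can_eq_g_coord[of "\<sigma> t" "\<sigma>' t" "\<sigma>' t"] in_Om[OF tI] V1[OF tI]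
      by (simp add: Omega_nondeg Omega_iff)
    then have "(dR (\<sigma> t) (\<sigma>' t))\<^sup>2 / 14 + 4 * (cW (\<sigma> t))\<^sup>2 * (dX (\<sigma> t) (\<sigma>' t))\<^sup>2 / (\<sigma> t $ 1 $ 1 * cD (\<sigma> t))
        + 3 / 2 * (\<sigma>' t $ 2 $ 2 / \<sigma> t $ 2 $ 2)\<^sup>2 + 4 * (dQ (\<sigma> t) (\<sigma>' t))\<^sup>2 / (\<sigma> t $ 2 $ 2 * cD (\<sigma> t)) \<le> 0"
      unfolding g_coord_sum_squares[OF in_Om[OF tI]] F by simp
    moreover have "0 \<le> (dR (\<sigma> t) (\<sigma>' t))\<^sup>2 / 14"
      "0 \<le> 4 * (cW (\<sigma> t))\<^sup>2 * (dX (\<sigma> t) (\<sigma>' t))\<^sup>2 / (\<sigma> t $ 1 $ 1 * cD (\<sigma> t))"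
      "0 \<le> 3 / 2 * (\<sigma>' t $ 2 $ 2 / \<sigma> t $ 2 $ 2)\<^sup>2" "0 \<le> 4 * (dQ (\<sigma> t) (\<sigma>' t))\<^sup>2 / (\<sigma> t $ 2 $ 2 * cD (\<sigma> t))"
      using pos by simp_all
    ultimately have "(dR (\<sigma> t) (\<sigma>' t))\<^sup>2 / 14 = 0"
      "4 * (cW (\<sigma> t))\<^sup>2 * (dX (\<sigma> t) (\<sigma>' t))\<^sup>2 / (\<sigma> t $ 1 $ 1 * cD (\<sigma> t)) = 0"
      "3 / 2 * (\<sigma>' t $ 2 $ 2 / \<sigma> t $ 2 $ 2)\<^sup>2 = 0" "4 * (dQ (\<sigma> t) (\<sigma>' t))\<^sup>2 / (\<sigma> t $ 2 $ 2 * cD (\<sigma> t)) = 0"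
      by linarith+
    then show ?thesis
      using pos by simp
  qed
  have const: "f t = f 0" if "continuous_on {0..1} f" "\<And>s. 0 < s \<Longrightarrow> s < 1 \<Longrightarrow> DERIV f s :> 0" for f :: "real \<Rightarrow> real"
    using DERIV_isconst2[of 0 1 f t] that t by simp
  show "cX (\<sigma> t) = cX (\<sigma> 0)"
  proof (rule const[OF conts(2)])
    show "((\<lambda>t. cX (\<sigma> t)) has_real_derivative 0) (at s)" if "0 < s" "s < 1" for s
      using DERIV_cX[OF d[OF that] in_Om[of s]] zero[OF that] that by simp
  qed
  show "cR (\<sigma> t) = cR (\<sigma> 0)"
  proof (rule const[OF conts(3)])
    show "((\<lambda>t. cR (\<sigma> t)) has_real_derivative 0) (at s)" if "0 < s" "s < 1" for s
      using DERIV_cR[OF d[OF that] in_Om[of s]] zero[OF that] that by simp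
  qed
  show "cQ (\<sigma> t) = cQ (\<sigma> 0)"
  proof (rule const[OF conts(4)])
    show "((\<lambda>t. cQ (\<sigma> t)) has_real_derivative 0) (at s)" if "0 < s" "s < 1" for s
      using DERIV_cQ[OF d[OF that]] zero[OF that] Omega_pos(2)[OF in_Om[of s]] that by simp
  qed
  show "\<sigma> t $ 2 $ 2 = \<sigma> 0 $ 2 $ 2"
  proof (rule const)
    show "continuous_on {0..1} (\<lambda>t. \<sigma> t $ 2 $ 2)"
      by (intro continuous_intros cont)
    show "((\<lambda>t. \<sigma> t $ 2 $ 2) has_real_derivative 0) (at s)" if "0 < s" "s < 1" for s
      using has_real_derivative_entry[OF d[OF that], of 2 2] zero[OF that] by simp
  qed
qed

section \<open>An explicit geodesic\<close>

text \<open>The elements of \<open>V\<close> with vanishing (2,3) entry, that is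
  \<open>cQ = 0\<close>; the whole example lives here.\<close>

definition slice :: "real \<Rightarrow> real \<Rightarrow> real \<Rightarrow> real \<Rightarrow> real^3^3" where
  "slice a b p r = vector [vector [a, 0, p], vector [0, b, 0], vector [p, 0, r]]"

lemma slice_entries [simp]:
  "slice a b p r $ 1 $ 1 = a" "slice a b p r $ 1 $ 2 = 0" "slice a b p r $ 1 $ 3 = p"
  "slice a b p r $ 2 $ 1 = 0" "slice a b p r $ 2 $ 2 = b" "slice a b p r $ 2 $ 3 = 0"
  "slice a b p r $ 3 $ 1 = p" "slice a b p r $ 3 $ 2 = 0" "slice a b p r $ 3 $ 3 = r"
  by (simp_all add: slice_def)

lemma slice_in_V: "slice a b p r \<in> V"
  by (simp add: V_iff)

lemma has_vector_derivative_slice: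
  assumes "(a has_real_derivative a') (at t within S)" "(b has_real_derivative b') (at t within S)"
    "(p has_real_derivative p') (at t within S)" "(r has_real_derivative r') (at t within S)"
  shows "((\<lambda>t. slice (a t) (b t) (p t) (r t)) has_vector_derivative slice a' b' p' r') (at t within S)"
proof -
  have eq: "slice a b p r = a *\<^sub>R slice 1 0 0 0 + b *\<^sub>R slice 0 1 0 0 + p *\<^sub>R slice 0 0 1 0 + r *\<^sub>R slice 0 0 0 1"
    for a b p r
    by (simp add: vec_eq_iff forall_3)
  have lin: "((\<lambda>t. f t *\<^sub>R M) has_vector_derivative f' *\<^sub>R M) (at t within S)"
    if "(f has_real_derivative f') (at t within S)" for f f' and M :: "real^3^3"
    using has_vector_derivative_scaleR[OF that has_vector_derivative_const] by simp
  show ?thesis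
    unfolding eq[of "a _"] eq[of a'] by (intro has_vector_derivative_add lin assms)
qed

lemma Phi_unip: "\<Phi> (unip p) = slice 1 1 p (p\<^sup>2 + 1)"
  by (simp add: \<Phi>_def vec_eq_iff forall_3 matrix_matrix_mult_def sum_3 transpose_def power2_eq_square)

text \<open>The hyperbolic distance of the end points, 2 artanh(1/13) = ln(14/12).\<close>

abbreviation rate :: real where "rate \<equiv> ln (7 / 6)"

text \<open>The semicircle is traversed with constant speed as \<open>(1 + tanh s, sech s)\<close>, up to scaling. The values
  \<open>P = 6/7\<close> and \<open>P = 1\<close> are chosen such that \<open>tanh s = \<plusminus>1/13\<close> at the end points, and the factor \<open>ff\<close> keeps
  \<open>3 ln x\<^sub>1 + 4 ln D\<close> constant.\<close>

definition hh :: "real \<Rightarrow> real" where "hh t = tanh ((t - 1 / 2) * rate)"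
definition ff :: "real \<Rightarrow> real" where "ff t = exp (- (4 / 7) * ln (169 / 168 * (1 - (hh t)\<^sup>2)))"

definition geo0 :: "real \<Rightarrow> real^3^3" where
  "geo0 t = slice (ff t) 1 (ff t * (13 / 14 * (1 + hh t))) (ff t * (169 / 1176 * (13 + 12 * hh t - (hh t)\<^sup>2)))"

text \<open>First derivative of \<open>geo0\<close>. The bracketed factors stay polynomial in
  \<open>hh\<close> because \<open>hh\<close> has derivative
  \<open>rate * (1 - (hh t)\<^sup>2)\<close> and \<open>ff\<close> has logarithmic derivative
  \<open>rate * (8 / 7 * hh t)\<close>.\<close>

definition geo1 :: "real \<Rightarrow> real^3^3" where
  "geo1 t = slice (rate * ff t * (8 / 7 * hh t)) 0 (rate * ff t * (13 / 98 * (7 + 8 * hh t + (hh t)\<^sup>2)))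
     (rate * ff t * (169 / 1372 * (14 + 15 * hh t + 2 * (hh t)\<^sup>2 + (hh t) ^ 3)))"

definition geo2 :: "real \<Rightarrow> real^3^3" where
  "geo2 t = slice (rate\<^sup>2 * ff t * (8 / 49 * (7 + (hh t)\<^sup>2))) 0
     (rate\<^sup>2 * ff t * (13 / 343 * (28 + 35 * hh t + 4 * (hh t)\<^sup>2 - 3 * (hh t) ^ 3)))
     (rate\<^sup>2 * ff t * (169 / 9604 * (105 + 140 * hh t + 36 * (hh t)\<^sup>2 - 12 * (hh t) ^ 3 - 13 * (hh t) ^ 4)))"

lemma hh_sq_less_1: "(hh t)\<^sup>2 < 1"
  using tanh_real_bounds[of "(t - 1 / 2) * rate"] by (simp add: hh_def abs_square_less_1 abs_if)

lemma ff_pos: "0 < ff t"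
  by (simp add: ff_def)

lemma DERIV_hh: "(hh has_real_derivative rate * (1 - (hh t)\<^sup>2)) (at t within S)"
  unfolding hh_def by (auto intro!: derivative_eq_intros)

lemma DERIV_ff: "(ff has_real_derivative rate * ff t * (8 / 7 * hh t)) (at t within S)"
proof -
  have q: "0 < 1 - (hh t)\<^sup>2" "(hh t)\<^sup>2 \<noteq> 1"
    using hh_sq_less_1[of t] by simp_all
  have "((\<lambda>t. ln (169 / 168 * (1 - (hh t)\<^sup>2))) has_real_derivative - 2 * hh t * rate) (at t within S)"
    using q by (auto intro!: derivative_eq_intros DERIV_hh simp: field_simps)
  from DERIV_chain2[OF DERIV_exp DERIV_cmult[OF this, of "- (4 / 7)"]] show ?thesis
    unfolding ff_def by (rule DERIV_cong) simp
qed

lemma geo0_deriv: "(geo0 has_vector_derivative geo1 t) (at t within S)"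
  unfolding geo0_def[abs_def] geo1_def
  by (intro has_vector_derivative_slice)
     (auto intro!: derivative_eq_intros DERIV_ff[THEN DERIV_cong] DERIV_hh simp: field_simps power2_eq_square power3_eq_cube)

lemma geo1_deriv: "(geo1 has_vector_derivative geo2 t) (at t within S)"
  unfolding geo1_def[abs_def] geo2_def
  by (intro has_vector_derivative_slice)
     (auto intro!: derivative_eq_intros DERIV_ff[THEN DERIV_cong] DERIV_hh
        simp: field_simps power2_eq_square power3_eq_cube power4_eq_xxxx)

text \<open>In Cholesky coordinates the factor \<open>1 - (hh t)\<^sup>2\<close> splits off and can
  cancel against the one in \<open>cD\<close>.\<close>

lemma geo_coords:
  shows "cP (geo0 t) = 13 / 14 * (1 + hh t)" "cQ (geo0 t) = 0"
    "cD (geo0 t) = ff t * (169 / 168 * (1 - (hh t)\<^sup>2))"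
    "dP (geo0 t) (geo1 t) = rate * ff t * (13 / 14 * (1 - (hh t)\<^sup>2))"
    "dQ (geo0 t) (geo1 t) = 0"
    "dD (geo0 t) (geo1 t) = - rate * ff t * (169 / 196 * (hh t * (1 - (hh t)\<^sup>2)))"
    "dP (geo0 t) (geo2 t) = rate\<^sup>2 * ff t * (13 / 49 * (hh t * (1 - (hh t)\<^sup>2)))"
    "dQ (geo0 t) (geo2 t) = 0"
    "dD (geo0 t) (geo2 t) = rate\<^sup>2 * ff t * (169 / 1372 * ((1 - (hh t)\<^sup>2) * (7 - (hh t)\<^sup>2)))"
proof -
  show P: "cP (geo0 t) = 13 / 14 * (1 + hh t)" and Q: "cQ (geo0 t) = 0"
    using ff_pos[of t] by (simp_all add: cP_def cQ_def geo0_def)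
  show "cD (geo0 t) = ff t * (169 / 168 * (1 - (hh t)\<^sup>2))"
    using ff_pos[of t] by (simp add: cD_def geo0_def field_simps power2_eq_square)
  show "dP (geo0 t) (geo1 t) = rate * ff t * (13 / 14 * (1 - (hh t)\<^sup>2))"
    unfolding dP_def P by (simp add: geo1_def field_simps power2_eq_square)
  show "dP (geo0 t) (geo2 t) = rate\<^sup>2 * ff t * (13 / 49 * (hh t * (1 - (hh t)\<^sup>2)))"
    unfolding dP_def P by (simp add: geo2_def field_simps power2_eq_square power3_eq_cube)
  show "dQ (geo0 t) (geo1 t) = 0" "dQ (geo0 t) (geo2 t) = 0"
    unfolding dQ_def Q by (simp_all add: geo1_def geo2_def)
  show "dD (geo0 t) (geo1 t) = - rate * ff t * (169 / 196 * (hh t * (1 - (hh t)\<^sup>2)))"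
    unfolding dD_def P Q by (simp add: geo1_def field_simps power2_eq_square power3_eq_cube)
  show "dD (geo0 t) (geo2 t) = rate\<^sup>2 * ff t * (169 / 1372 * ((1 - (hh t)\<^sup>2) * (7 - (hh t)\<^sup>2)))"
    unfolding dD_def P Q by (simp add: geo2_def field_simps power2_eq_square power3_eq_cube power4_eq_xxxx)
qed

lemma geo0_in_Omega: "geo0 t \<in> \<Omega>"
  using ff_pos[of t] hh_sq_less_1[of t] slice_in_V
  by (simp add: Omega_iff geo_coords) (simp add: geo0_def)

lemma geo_diag:
  "geo0 t $ 1 $ 1 = ff t" "geo0 t $ 2 $ 2 = 1"
  "geo1 t $ 1 $ 1 = rate * ff t * (8 / 7 * hh t)" "geo1 t $ 2 $ 2 = 0"
  "geo2 t $ 1 $ 1 = rate\<^sup>2 * ff t * (8 / 49 * (7 + (hh t)\<^sup>2))" "geo2 t $ 2 $ 2 = 0"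
  by (simp_all add: geo0_def geo1_def geo2_def)

lemma geo_speed: "g_can (geo0 t) (geo1 t) (geo1 t) = 24 / 7 * rate\<^sup>2"
proof -
  define h f q k where "h = hh t" and "f = ff t" and "q = 1 - h\<^sup>2" and "k = rate"
  have pos: "0 < f" "0 < q"
    using ff_pos hh_sq_less_1 by (simp_all add: f_def q_def h_def)
  have h: "h * h = 1 - q"
    by (simp add: q_def power2_eq_square)
  have "g_can (geo0 t) (geo1 t) (geo1 t) = g_coord (geo0 t) (geo1 t) (geo1 t)"
    by (intro g_can_eq_g_coord Omega_nondeg geo0_in_Omega) (simp_all add: geo0_def geo1_def slice_in_V)
  also have "\<dots> = 3 / 2 * (k * f * (8 / 7 * h) * (k * f * (8 / 7 * h)) / f\<^sup>2)
     + 2 * (- k * f * (169 / 196 * (h * q))) * (- k * f * (169 / 196 * (h * q))) / (f * (169 / 168 * q))\<^sup>2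
     + 4 * (k * f * (13 / 14 * q)) * (k * f * (13 / 14 * q)) / (f * (f * (169 / 168 * q)))"
    unfolding g_coord_def geo_coords geo_diag by (simp add: h_def f_def q_def k_def)
  \<comment> \<open>Here \<open>h * h + q\<close> is tanh^2 + sech^2, which is 1.\<close>
  also have "\<dots> = 24 / 7 * k\<^sup>2 * (h * h + q)"
    using pos by (simp add: field_simps power2_eq_square)
  also have "\<dots> = 24 / 7 * rate\<^sup>2"
    by (simp add: h k_def)
  finally show ?thesis .
qed

lemma geo_equation:
  assumes "w \<in> V"
  shows "g_can (geo0 t) (geo2 t) w + christoffel g_can (geo0 t) (geo1 t) (geo1 t) w = 0"
proof -
  \<comment> \<open>\<open>q\<close> remains a separate positive symbol that can be cancelled; its
    relation to \<open>h\<close> enters only at the end.\<close>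
  define h f q k where "h = hh t" and "f = ff t" and "q = 1 - h\<^sup>2" and "k = rate"
  have pos: "0 < f" "0 < q"
    using ff_pos hh_sq_less_1 by (simp_all add: f_def q_def h_def)
  define D A\<^sub>1 Z\<^sub>1 D\<^sub>1 A\<^sub>2 Z\<^sub>2 D\<^sub>2 where "D = cD (geo0 t)"
    and "A\<^sub>1 = geo1 t $ 1 $ 1" and "Z\<^sub>1 = dP (geo0 t) (geo1 t)" and "D\<^sub>1 = dD (geo0 t) (geo1 t)"
    and "A\<^sub>2 = geo2 t $ 1 $ 1" and "Z\<^sub>2 = dP (geo0 t) (geo2 t)" and "D\<^sub>2 = dD (geo0 t) (geo2 t)"
  note defs = D_def A\<^sub>1_def Z\<^sub>1_def D\<^sub>1_def A\<^sub>2_def Z\<^sub>2_def D\<^sub>2_def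
  have at_t: "D = f * (169 / 168 * q)"
    "A\<^sub>1 = k * f * (8 / 7 * h)" "Z\<^sub>1 = k * f * (13 / 14 * q)" "D\<^sub>1 = - k * f * (169 / 196 * (h * q))"
    "A\<^sub>2 = k\<^sup>2 * f * (8 / 49 * (7 + h\<^sup>2))" "Z\<^sub>2 = k\<^sup>2 * f * (13 / 49 * (h * q))"
    "D\<^sub>2 = k\<^sup>2 * f * (169 / 1372 * (q * (7 - h\<^sup>2)))"
    by (simp_all only: defs geo_coords geo_diag h_def f_def q_def k_def)
  have V: "geo0 t \<in> V" "geo1 t \<in> V" "geo2 t \<in> V"
    by (simp_all add: geo0_def geo1_def geo2_def slice_in_V)
  define a z d where "a = w $ 1 $ 1" and "z = dP (geo0 t) w" and "d = dD (geo0 t) w"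
  have "g_can (geo0 t) (geo2 t) w + christoffel g_can (geo0 t) (geo1 t) (geo1 t) w
      = g_coord (geo0 t) (geo2 t) w + dg_coord (geo0 t) (geo1 t) (geo1 t) w / 2"
    using assms by (simp add: g_can_eq_g_coord christoffel_g_can V Omega_nondeg geo0_in_Omega)
  \<comment> \<open>Sorting by the components \<open>a\<close>, \<open>d\<close>, \<open>z\<close>
    of \<open>w\<close>; its (2,2) and \<open>dQ\<close> components meet only zero factors. The
    first two coefficients turn out to be multiples of \<open>1 - h\<^sup>2 - q\<close>, the third
    is 0.\<close>
  also have "\<dots> =
      a * (3 / 2 * A\<^sub>2 / f\<^sup>2 - 3 / 2 * A\<^sub>1\<^sup>2 / f ^ 3 - 2 * Z\<^sub>1\<^sup>2 / (f\<^sup>2 * D))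
    + d * (2 * D\<^sub>2 / D\<^sup>2 - 2 * D\<^sub>1\<^sup>2 / D ^ 3 - 2 * Z\<^sub>1\<^sup>2 / (f * D\<^sup>2))
    + z * (4 * Z\<^sub>2 / (f * D) - 4 * Z\<^sub>1 * D\<^sub>1 / (f * D\<^sup>2) - 4 * Z\<^sub>1 * A\<^sub>1 / (f\<^sup>2 * D))"
    unfolding g_coord_def dg_coord_def geo_coords(2,5,8) geo_diag(1,2,4,6)
      defs[symmetric] a_def[symmetric] z_def[symmetric] d_def[symmetric] f_def[symmetric]
    by (simp add: add_divide_distrib diff_divide_distrib power2_eq_square algebra_simps)
  also have "3 / 2 * A\<^sub>2 / f\<^sup>2 - 3 / 2 * A\<^sub>1\<^sup>2 / f ^ 3 - 2 * Z\<^sub>1\<^sup>2 / (f\<^sup>2 * D) = 12 / 7 * k\<^sup>2 / f * (1 - h\<^sup>2 - q)"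
    unfolding at_t using pos by (simp add: field_simps power2_eq_square power3_eq_cube)
  also have "2 * D\<^sub>2 / D\<^sup>2 - 2 * D\<^sub>1\<^sup>2 / D ^ 3 - 2 * Z\<^sub>1\<^sup>2 / (f * D\<^sup>2) = 288 / 169 * k\<^sup>2 / (f * q) * (1 - h\<^sup>2 - q)"
    unfolding at_t using pos by (simp add: field_simps power2_eq_square power3_eq_cube)
  also have "4 * Z\<^sub>2 / (f * D) - 4 * Z\<^sub>1 * D\<^sub>1 / (f * D\<^sup>2) - 4 * Z\<^sub>1 * A\<^sub>1 / (f\<^sup>2 * D) = 0"
    unfolding at_t using pos by (simp add: field_simps power2_eq_square)
  finally show ?thesis
    by (simp add: q_def)
qed

lemma geodesic_geo0: "geodesic_in V \<Omega> g_can geo0"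
  unfolding geodesic_in_def
  using geo0_in_Omega geo0_deriv geo1_deriv geo_equation by blast

lemma ff_eq_1: "(hh t)\<^sup>2 = 1 / 169 \<Longrightarrow> ff t = 1"
  by (simp add: ff_def)

lemma geo0_0: "geo0 0 = \<Phi> (unip (6 / 7))"
proof -
  have h: "hh 0 = - 1 / 13"
    by (simp add: hh_def tanh_real_altdef exp_minus)
  have f: "ff 0 = 1"
    by (rule ff_eq_1) (simp add: h power2_eq_square)
  show ?thesis
    by (simp add: geo0_def Phi_unip h f power2_eq_square)
qed

lemma geo0_1: "geo0 1 = \<Phi> (unip 1)"
proof -
  have h: "hh 1 = 1 / 13"
    by (simp add: hh_def tanh_real_altdef exp_minus)
  have f: "ff 1 = 1"
    by (rule ff_eq_1) (simp add: h power2_eq_square)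
  show ?thesis
    by (simp add: geo0_def Phi_unip h f power2_eq_square)
qed

lemma cF_Phi_unip: "cF (\<Phi> (unip p)) = - ln (1 + 7 / 6 * p\<^sup>2)"
  by (simp add: Phi_unip cF_def cW_def cD_def cP_def)

text \<open>The drop of \<open>cF\<close> equals the hyperbolic distance, so \<open>geo0\<close>
  attains the length bound.\<close>

lemma cF_drop: "cF (\<Phi> (unip (6 / 7))) - cF (\<Phi> (unip 1)) = rate"
proof -
  have "ln (13 / 6) - ln (13 / 7) = ln (13 / 6 / (13 / 7) :: real)"
    by (subst ln_div) simp_all
  then show ?thesis
    by (simp add: cF_Phi_unip power2_eq_square)
qed

lemma geo0_length: "(speed g_can geo0 has_integral sqrt (24 / 7) * rate) {0..1}"
proof -
  have "sqrt (24 / 7 * rate\<^sup>2) = sqrt (24 / 7) * rate"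
    by (simp only: real_sqrt_mult real_sqrt_abs) simp
  then show ?thesis
    using riem_length_constant_speed[of geo0 geo1 g_can "24 / 7 * rate\<^sup>2"] geo0_deriv geo_speed by simp
qed

text \<open>Makes \<open>geo0\<close> a competitor for any other minimizing geodesic, which then
  attains the length bound too.\<close>

lemma admissible_geo0: "admissible_curve \<Omega> g_can geo0 (\<Phi> (unip (6 / 7))) (\<Phi> (unip 1))"
proof -
  have "geo0 C1_differentiable_on {0..1}"
    unfolding C1_differentiable_on_def
    using geo0_deriv[of _ UNIV] has_vector_derivative_continuous[OF geo1_deriv]
    by (auto simp: continuous_on_eq_continuous_within)
  moreover have "continuous_on {0..1} geo0"
    using has_vector_derivative_continuous[OF geo0_deriv] by (auto simp: continuous_on_eq_continuous_within)
  ultimately have "geo0 piecewise_C1_differentiable_on {0..1}"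
    unfolding piecewise_C1_differentiable_on_def by (metis Diff_empty finite.emptyI)
  then show ?thesis
    using geo0_length geo0_in_Omega geo0_0 geo0_1 by (auto simp: admissible_curve_def integrable_on_def)
qed

theorem corollary5p2:
  shows "\<exists>x\<in>\<Omega>. \<exists>y\<in>\<Omega>. \<exists>\<sigma>.
           minimizing_geodesic V \<Omega> g_can \<sigma> x y \<and>
           (\<forall>\<tau>. minimizing_geodesic V \<Omega> g_can \<tau> x y \<longrightarrow> (\<forall>t\<in>{0..1}. \<tau> t = \<sigma> t)) \<and>
           cv_mean x y \<noteq> \<sigma> (1 / 2)"
proof -
  let ?x = "\<Phi> (unip (6 / 7))" and ?y = "\<Phi> (unip 1)"
  have xy: "?x \<in> \<Omega>" "?y \<in> \<Omega>"
    using geo0_in_Omega[of 0] geo0_in_Omega[of 1] by (simp_all add: geo0_0 geo0_1)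
  have len: "riem_length g_can geo0 = sqrt (24 / 7) * (cF ?x - cF ?y)"
    using geo0_length by (simp only: riem_length_def integral_unique cF_drop)
  have "minimizing_geodesic V \<Omega> g_can geo0 ?x ?y"
    unfolding minimizing_geodesic_def len
    using geodesic_geo0 geo0_0 geo0_1 riem_length_ge by blast
  \<comment> \<open>Both curves attain the bound, so at each time their adapted coordinates are
    prescribed by the common end points.\<close>
  moreover have "\<tau> t = geo0 t" if \<tau>: "minimizing_geodesic V \<Omega> g_can \<tau> ?x ?y" and t: "t \<in> {0..1}" for \<tau> t
  proof -
    have geo: "geodesic_in V \<Omega> g_can \<tau>" and ends: "\<tau> 0 = ?x" "\<tau> 1 = ?y"
      using \<tau> by (auto simp: minimizing_geodesic_def)
    have "riem_length g_can \<tau> \<le> riem_length g_can geo0"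
      using \<tau> admissible_geo0 by (auto simp: minimizing_geodesic_def)
    then have short: "riem_length g_can \<tau> \<le> sqrt (24 / 7) * (cF (\<tau> 0) - cF (\<tau> 1))"
      by (simp add: ends len)
    have short0: "riem_length g_can geo0 \<le> sqrt (24 / 7) * (cF (geo0 0) - cF (geo0 1))"
      by (simp add: geo0_0 geo0_1 len)
    have "\<tau> t \<in> \<Omega>"
      using geo t by (auto simp: geodesic_in_def)
    then show ?thesis
      using short_geodesic_coords[OF geo short t] short_geodesic_coords[OF geodesic_geo0 short0 t]
      by (intro adapted_coords_inject geo0_in_Omega) (simp_all only: ends geo0_0 geo0_1)
  qed
  moreover have "cv_mean ?x ?y \<noteq> geo0 (1 / 2)"
  proof -
    have "cv_mean ?x ?y $ 1 $ 1 = 1"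
      by (simp add: cv_mean_unip) (simp add: Phi_unip)
    \<comment> \<open>At the midpoint \<open>hh\<close> vanishes and the entry is
      (168/169)^(4/7).\<close>
    moreover have "geo0 (1 / 2) $ 1 $ 1 \<noteq> 1"
      by (simp add: geo_diag ff_def hh_def)
    ultimately show ?thesis by metis
  qed
  ultimately show ?thesis
    using xy by blast
qed

end
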